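(* Let $d\ge1$ and let $Z$ be the interacting branching diffusion in $\mathbb{R}^d$ with drift parameter $b$ and interaction parameter $\gamma$, where $b<0$ and $\gamma>0$. Then $Z$ suffers local extinction: almost surely, as $n\to\infty$ through the integers, $Z_n(\mathrm{d}y)$ converges vaguely to the zero measure on $\mathbb{R}^d$.
   Context: Model. Fix $d\ge1$, $b\in\mathbb{R}$ and $\gamma\neq 0$. The process $Z$ starts at time $0$ with one particle at the origin of $\mathbb{R}^d$. For each $m=0,1,2,\dots$, during the time interval $[m,m+1)$ there are exactly $2^m$ particles, with positions $Z_t^i$, $1\le i\le 2^m$; at each integer time $m\ge 1$ every particle is replaced by exactly two offspring, located at the parent's position (labels are arbitrary but independent of the spatial motion). On $[m,m+1)$ the positions satisfy $$\mathrm{d}Z_t^i = \mathrm{d}W_t^{i,m} - bZ_t^i\,\mathrm{d}t + \frac{1}{2^m}\sum_{j=1}^{2^m}\gamma\,(Z_t^j-Z_t^i)\,\mathrm{d}t,\qquad 1\le i\le 2^m,$$ where $\{W^{i,m}\}_{1\le i\le 2^m}$ are independent standard $d$-dimensional Brownian motions on $[m,m+1)$, also independent of the past up to time $m$. The associated discrete measure-valued process is $Z_t(\mathrm{d}y):=\sum_{i=1}^{2^{\lfloor t\rfloor}}\delta_{Z_t^i}(\mathrm{d}y)$. Local extinction of $Z$ means, by definition, that almost surely $Z_n(\mathrm{d}y)$ converges vaguely to $0$ as $n\to\infty$. *)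

theory Defs
  imports "HOL-Probability.Probability"
begin

definition sigma_field_of ::
  "'w measure \<Rightarrow> 'b measure \<Rightarrow> 'k set \<Rightarrow> ('k \<Rightarrow> 'w \<Rightarrow> 'b) \<Rightarrow> 'w set set" where
  "sigma_field_of M N K X =
     sets (vimage_algebra (space M) (\<lambda>\<omega>. \<lambda>k\<in>K. X k \<omega>) (PiM K (\<lambda>_. N)))"

text \<open>Standard \<open>d\<close>-dimensional Brownian motion on the time interval \<open>[a,b)\<close>, started
  from 0 at time \<open>a\<close>.  The increment over \<open>[s,t]\<close> has the law
  \<open>N(0, (t - s) I)\<close>, written through its Lebesgue density.\<close>

definition standard_BM_on ::
  "'w measure \<Rightarrow> real \<Rightarrow> real \<Rightarrow> (real \<Rightarrow> 'w \<Rightarrow> real ^ 'd) \<Rightarrow> bool" where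
  "standard_BM_on M a b W \<longleftrightarrow>
     (\<forall>t\<in>{a..<b}. W t \<in> borel_measurable M) \<and>
     (AE \<omega> in M. W a \<omega> = 0) \<and>
     (\<forall>s t. a \<le> s \<and> s < t \<and> t < b \<longrightarrow>
        distributed M lborel (\<lambda>\<omega>. W t \<omega> - W s \<omega>)
          (\<lambda>x. ennreal (\<Prod>k\<in>UNIV. normal_density 0 (sqrt (t - s)) (x $ k)))) \<and>
     (\<forall>(n::nat) \<tau>. (\<forall>k\<le>n. \<tau> k \<in> {a..<b}) \<and> (\<forall>k<n. \<tau> k < \<tau> (Suc k)) \<longrightarrow>
        prob_space.indep_vars M (\<lambda>_. borel) (\<lambda>k \<omega>. W (\<tau> (Suc k)) \<omega> - W (\<tau> k) \<omega>) {..<n}) \<and>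
     (AE \<omega> in M. continuous_on {a..<b} (\<lambda>t. W t \<omega>))"

text \<open>Labels of the particles alive at time \<open>t \<ge> 0\<close>.\<close>

definition alive :: "real \<Rightarrow> nat set" where
  "alive t = {1..2 ^ nat \<lfloor>t\<rfloor>}"

text \<open>\<open>Z t i\<close> is the position at time \<open>t\<close> of the particle labelled \<open>i\<close>, and \<open>W m i\<close> is the
  Brownian motion driving particle \<open>i\<close> during \<open>[m, m + 1)\<close>.  The (possibly random) label
  \<open>par m i\<close> is that of the parent, alive during \<open>[m, m + 1)\<close>, of the particle labelled
  \<open>i\<close> born at time \<open>m + 1\<close>.  The noise being additive, the stochastic differential equation
  is a pathwise integral equation; the position of the parent at the branching time is its
  left limit.\<close>

locale interacting_branching_diffusion = prob_space M
  for M :: "'w measure" +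
  fixes b \<gamma> :: real
    and W :: "nat \<Rightarrow> nat \<Rightarrow> real \<Rightarrow> 'w \<Rightarrow> real ^ 'd"
    and par :: "nat \<Rightarrow> nat \<Rightarrow> 'w \<Rightarrow> nat"
    and Z :: "real \<Rightarrow> nat \<Rightarrow> 'w \<Rightarrow> real ^ 'd"
  assumes gamma_nonzero: "\<gamma> \<noteq> 0"
    and measurable_Z: "\<And>t i. 0 \<le> t \<Longrightarrow> i \<in> alive t \<Longrightarrow> Z t i \<in> borel_measurable M"
    and measurable_par:
      "\<And>m i. i \<in> {1..2 ^ Suc m} \<Longrightarrow> par m i \<in> measurable M (count_space UNIV)"
    and BM: "\<And>m i. i \<in> {1..2 ^ m} \<Longrightarrow> standard_BM_on M (real m) (real m + 1) (W m i)"
    and BM_indep: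
      "\<And>m. indep_sets (\<lambda>i. sigma_field_of M borel {real m..<real m + 1} (W m i)) {1..2 ^ m}"
    and BM_indep_past:
      "\<And>m. indep_set
         (sigma_field_of M borel ({1..2 ^ m} \<times> {real m..<real m + 1}) (\<lambda>(i, t). W m i t))
         (sigma_field_of M borel (SIGMA s:{0..real m}. alive s) (\<lambda>(s, i). Z s i))"
    and labels_indep:
      "indep_set
         (sigma_field_of M (count_space UNIV) (SIGMA m:UNIV. {1..2 ^ Suc m}) (\<lambda>(m, i). par m i))
         (sigma_field_of M borel
            (SIGMA m:UNIV. {1..2 ^ m} \<times> {real m..<real m + 1}) (\<lambda>(m, i, t). W m i t))"
    and start: "AE \<omega> in M. Z 0 1 \<omega> = 0"
    and two_offspring:
      "AE \<omega> in M. \<forall>m.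
         (\<forall>i\<in>{1..2 ^ Suc m}. par m i \<omega> \<in> {1..2 ^ m}) \<and>
         (\<forall>j\<in>{1..2 ^ m}. card {i \<in> {1..2 ^ Suc m}. par m i \<omega> = j} = 2)"
    and born_at_parent:
      "AE \<omega> in M. \<forall>m. \<forall>i\<in>{1..2 ^ Suc m}.
         ((\<lambda>t. Z t (par m i \<omega>) \<omega>) \<longlongrightarrow> Z (real (Suc m)) i \<omega>) (at_left (real (Suc m)))"
    and continuous_Z:
      "AE \<omega> in M. \<forall>m. \<forall>i\<in>{1..2 ^ m}. continuous_on {real m..<real m + 1} (\<lambda>t. Z t i \<omega>)"
    and SDE:
      "AE \<omega> in M. \<forall>m. \<forall>i\<in>{1..2 ^ m}. \<forall>t\<in>{real m..<real m + 1}.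
         Z t i \<omega> = Z (real m) i \<omega> + (W m i t \<omega> - W m i (real m) \<omega>)
           + integral {real m..t} (\<lambda>s. - b *\<^sub>R Z s i \<omega>
               + (1 / 2 ^ m) *\<^sub>R (\<Sum>j=1..2 ^ m. \<gamma> *\<^sub>R (Z s j \<omega> - Z s i \<omega>)))"

text \<open>The sum of Dirac measures at the positions of the particles alive at time \<open>t\<close>.\<close>

definition particle_measure ::
  "(real \<Rightarrow> nat \<Rightarrow> 'w \<Rightarrow> real ^ 'd) \<Rightarrow> real \<Rightarrow> 'w \<Rightarrow> (real ^ 'd) measure" where
  "particle_measure Z t \<omega> =
     measure_of UNIV (sets borel) (\<lambda>A. \<Sum>i\<in>alive t. emeasure (return borel (Z t i \<omega>)) A)"

lemma space_particle_measure [simp]: "space (particle_measure Z t \<omega>) = UNIV"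
  and sets_particle_measure [simp]: "sets (particle_measure Z t \<omega>) = sets borel"
  unfolding particle_measure_def
  by (auto simp: space_measure_of_conv sets.sigma_sets_eq[of borel, simplified])

lemma emeasure_particle_measure:
  fixes Z :: "real \<Rightarrow> nat \<Rightarrow> 'w \<Rightarrow> real ^ 'd"
  assumes "A \<in> sets borel"
  shows "emeasure (particle_measure Z t \<omega>) A = (\<Sum>i\<in>alive t. indicator A (Z t i \<omega>))"
proof -
  have "countably_additive (sets borel)
      (\<lambda>A. \<Sum>i\<in>alive t. emeasure (return borel (Z t i \<omega>)) A)"
  proof (rule countably_additiveI)
    fix A :: "nat \<Rightarrow> (real ^ 'd) set"
    assume A: "range A \<subseteq> sets borel" "disjoint_family A"
    show "(\<Sum>n. \<Sum>i\<in>alive t. emeasure (return borel (Z t i \<omega>)) (A n)) =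
        (\<Sum>i\<in>alive t. emeasure (return borel (Z t i \<omega>)) (\<Union> (range A)))"
      using A by (subst suminf_sum)
        (auto intro!: sum.cong suminf_emeasure simp del: emeasure_return)
  qed
  then have "emeasure (particle_measure Z t \<omega>) A =
      (\<Sum>i\<in>alive t. emeasure (return borel (Z t i \<omega>)) A)"
    using assms
    by (intro emeasure_measure_of[OF particle_measure_def]) (auto simp: positive_def)
  then show ?thesis
    using assms by simp
qed

definition vague_conv ::
  "(nat \<Rightarrow> 'a::topological_space measure) \<Rightarrow> 'a measure \<Rightarrow> bool" where
  "vague_conv \<mu>s \<mu> \<longleftrightarrow>
     (\<forall>f :: 'a \<Rightarrow> real. continuous_on UNIV f \<and> compact (closure {x. f x \<noteq> 0}) \<longrightarrow>
        (\<lambda>n. integral\<^sup>L (\<mu>s n) f) \<longlonglongrightarrow> integral\<^sup>L \<mu> f)"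

definition local_extinction ::
  "'w measure \<Rightarrow> (real \<Rightarrow> nat \<Rightarrow> 'w \<Rightarrow> real ^ 'd) \<Rightarrow> bool" where
  "local_extinction M Z \<longleftrightarrow>
     (AE \<omega> in M. vague_conv (\<lambda>n. particle_measure Z (real n) \<omega>) (null_measure borel))"

end

theory Submission
  imports Defs
begin

text \<open>
  The average position of the particles feels no interaction: it solves a linear equation with
  outward drift \<open>- b > 0\<close>, so the average at time \<open>m\<close> is of order \<open>exp (- b m)\<close>.  The deviation of
  a particle from the average solves a linear equation with the smaller rate \<open>- b - \<gamma>\<close>, because
  the attraction towards the average is proportional to the deviation.  Hence even the largest
  of the \<open>2 ^ m\<close> deviations is of smaller order than the average, and the whole cloud leaves every
  bounded set together with its average.  It suffices to follow one coordinate.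

  Two points need probability.  The first is a bound for the noise received by all particles
  during \<open>[m, m + 1)\<close>.  The noise of one particle is a limit of Gaussian sums whose variance is
  bounded uniformly in \<open>m\<close>, so the probability that one of \<open>2 ^ m\<close> noises exceeds \<open>2 m\<close> is at most
  a constant times \<open>(2 exp (- 2)) ^ m\<close>.  By Borel--Cantelli the noise is eventually bounded by \<open>2 m\<close>
  (\<open>AE_noise_bound\<close>), which is negligible against \<open>exp (- b m)\<close>.  What follows is deterministic: the
  discounted average \<open>exp (b m) mean\<close> converges, and the discounted maximal deviation satisfies
  \<open>r (m + 1) \<le> exp (- \<gamma>) r m + o(1)\<close>, so that it tends to \<open>0\<close>
  (\<open>AE_discounted_deviation_vanishes\<close>).  This is where \<open>\<gamma> > 0\<close> enters.

  The second point is that the limit of the discounted average is almost surely not \<open>0\<close>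
  (\<open>AE_discounted_mean_convergent\<close>).  The average at time \<open>1\<close> is a limit of Gaussian variables with
  variance bounded below, so it lies in an interval of length \<open>2 e\<close> with probability at most a
  constant times \<open>e\<close>, uniformly over all such intervals.  This property survives the addition of an
  independent variable, hence passes from each generation to the next with the same constant
  after discounting, and it survives almost sure limits (\<open>small_balls_add_indep\<close>,
  \<open>small_balls_limit\<close>).  A variable with this property has no atom at \<open>0\<close>.

  Throughout, stochastic integrals are replaced by the sums \<open>exp_sum\<close>: they are exactly Gaussian, they
  are measurable functions of finitely many values of the driving motion, and along a solution of
  the linear equation they converge pathwise to the noise of one unit of time
  (\<open>exp_sum_tendsto\<close>).
\<close>

section \<open>Linear equations with additive noise\<close>

text \<open>The left-point Riemann sum of \<open>\<integral> exp (c (a + 1 - s)) dw(s)\<close> over \<open>[a, a + 1)\<close> with mesh \<open>1 / (n + 2)\<close>.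
The last of the \<open>n + 2\<close> cells is left out, since the path \<open>w\<close> is not defined at \<open>a + 1\<close>; there are
\<open>n + 1 \<ge> 1\<close> cells left, so the sum is never empty.\<close>

definition exp_sum :: "real \<Rightarrow> real \<Rightarrow> (real \<Rightarrow> real) \<Rightarrow> nat \<Rightarrow> real" where
  "exp_sum c a w n =
     (\<Sum>k<Suc n. exp (c * (1 - real k / real (n + 2))) *
        (w (a + real (Suc k) / real (n + 2)) - w (a + real k / real (n + 2))))"

text \<open>Discounted to time \<open>a + 1\<close>, a solution moves by the noise alone.  Over a short interval the
discount factor of the noise is frozen at the left end point, and the integral on the right is the error
made by this.\<close>

lemma exp_sum_step:
  fixes x w :: "real \<Rightarrow> real"
  assumes cont: "continuous_on {a..<a + 1} x"
    and eq: "\<And>t. t \<in> {a..<a + 1} \<Longrightarrow> x t = x a + (w t - w a) + integral {a..t} (\<lambda>s. c * x s)"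
    and pq: "a \<le> p" "p \<le> q" "q < a + 1"
  defines "g \<equiv> \<lambda>s. exp (c * (a + 1 - s))"
  shows "g q * x q - g p * x p - g p * (w q - w p) =
    integral {p..q} (\<lambda>s. c * (g p * x s - g s * x q))"
proof -
  have cx: "continuous_on {s..t} x" if "a \<le> s" "t < a + 1" for s t
    using cont by (rule continuous_on_subset) (use that in auto)
  have int: "(\<lambda>s. c * x s) integrable_on {s..t}" if "a \<le> s" "t < a + 1" for s t
    using that by (intro integrable_continuous_interval continuous_intros cx)
  have "integral {a..p} (\<lambda>s. c * x s) + integral {p..q} (\<lambda>s. c * x s) = integral {a..q} (\<lambda>s. c * x s)"
    using pq by (intro Henstock_Kurzweil_Integration.integral_combine int) auto
  then have w: "w q - w p = x q - x p - integral {p..q} (\<lambda>s. c * x s)"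
    using eq[of p] eq[of q] pq by simp
  have "((\<lambda>s. - g s) has_real_derivative c * g s) (at s within {p..q})" for s
    unfolding g_def by (rule derivative_eq_intros refl | simp)+
  then have "((\<lambda>s. c * g s) has_integral (- g q - - g p)) {p..q}"
    using pq by (intro fundamental_theorem_of_calculus)
      (auto simp: has_real_derivative_iff_has_vector_derivative)
  then have "((\<lambda>s. c * g s) has_integral (g p - g q)) {p..q}"
    by simp
  then have g: "integral {p..q} (\<lambda>s. c * g s) = g p - g q"
    by (rule integral_unique)
  have "integral {p..q} (\<lambda>s. c * (g p * x s - g s * x q)) =
      integral {p..q} (\<lambda>s. g p * (c * x s) - (c * g s) * x q)"
    by (simp add: algebra_simps)
  also have "\<dots> = g p * integral {p..q} (\<lambda>s. c * x s) - (g p - g q) * x q"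
    unfolding g[symmetric] using pq
    by (subst Henstock_Kurzweil_Integration.integral_diff)
      (auto intro!: integrable_continuous_interval continuous_intros cx simp: g_def)
  finally show ?thesis
    unfolding w by (simp add: algebra_simps)
qed

text \<open>Summing \<open>exp_sum_step\<close> over the cells telescopes on the left.  The errors add up to something small
because the solution and the discount factor are uniformly continuous once the left limit \<open>l\<close> is
used as the value at \<open>a + 1\<close>.\<close>

lemma exp_sum_tendsto:
  fixes x w :: "real \<Rightarrow> real"
  assumes cont: "continuous_on {a..<a + 1} x"
    and left: "(x \<longlongrightarrow> l) (at_left (a + 1))"
    and eq: "\<And>t. t \<in> {a..<a + 1} \<Longrightarrow> x t = x a + (w t - w a) + integral {a..t} (\<lambda>s. c * x s)"
  shows "exp_sum c a w \<longlonglongrightarrow> l - exp c * x a"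
proof -
  define g where "g s = exp (c * (a + 1 - s))" for s
  define y where "y t = (if t < a + 1 then x t else l)" for t
  have contg: "continuous_on {a..a + 1} g"
    unfolding g_def by (intro continuous_intros)
  have conty: "continuous_on {a..a + 1} y"
    unfolding continuous_on_def
  proof
    fix t assume t: "t \<in> {a..a + 1}"
    show "(y \<longlongrightarrow> y t) (at t within {a..a + 1})"
    proof (cases "t = a + 1")
      case True
      have "\<forall>\<^sub>F s in at_left (a + 1). x s = y s"
        by (auto simp: y_def eventually_at_filter)
      then have "(y \<longlongrightarrow> l) (at_left (a + 1))"
        using left by (rule Lim_transform_eventually[rotated])
      then show ?thesis
        by (simp add: True at_within_Icc_at_left y_def)
    next
      case False
      have "continuous_on {a..<a + 1} y"
        using cont by (rule continuous_on_eq) (simp add: y_def)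
      then have "(y \<longlongrightarrow> y t) (at t within {a..<a + 1})"
        using t False by (simp add: continuous_on_def)
      moreover have "at t within {a..a + 1} = at t within {a..<a + 1}"
        using t False by (intro at_within_nhd[of t "{..<a + 1}"]) auto
      ultimately show ?thesis
        by simp
    qed
  qed
  obtain G where G: "G > 0" "\<And>s. s \<in> {a..a + 1} \<Longrightarrow> \<bar>g s\<bar> \<le> G"
    using compact_imp_bounded[OF compact_continuous_image[OF contg compact_Icc]]
    unfolding bounded_pos by auto
  obtain B where B: "B > 0" "\<And>s. s \<in> {a..a + 1} \<Longrightarrow> \<bar>y s\<bar> \<le> B"
    using compact_imp_bounded[OF compact_continuous_image[OF conty compact_Icc]]
    unfolding bounded_pos by auto
  define \<tau> where "\<tau> n k = a + real k / real (n + 2)" for n k :: nat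
  have \<tau>: "a \<le> \<tau> n k" "\<tau> n k \<le> \<tau> n (Suc k)" "\<tau> n (Suc k) < a + 1"
    "\<tau> n (Suc k) - \<tau> n k = 1 / real (n + 2)" if "k < Suc n" for n k
    using that by (auto simp: \<tau>_def field_simps)
  define R where "R n = (g (\<tau> n (Suc n)) * y (\<tau> n (Suc n)) - g a * y a) - exp_sum c a w n" for n
  have Rsum: "R n = (\<Sum>k<Suc n. integral {\<tau> n k..\<tau> n (Suc k)}
      (\<lambda>s. c * (g (\<tau> n k) * x s - g s * x (\<tau> n (Suc k)))))" for n
  proof -
    have "g (\<tau> n (Suc n)) * y (\<tau> n (Suc n)) - g a * y a =
        (\<Sum>k<Suc n. g (\<tau> n (Suc k)) * y (\<tau> n (Suc k)) - g (\<tau> n k) * y (\<tau> n k))"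
      by (subst sum_lessThan_telescope) (simp add: \<tau>_def)
    moreover have "exp_sum c a w n = (\<Sum>k<Suc n. g (\<tau> n k) * (w (\<tau> n (Suc k)) - w (\<tau> n k)))"
      unfolding exp_sum_def g_def \<tau>_def by (simp add: algebra_simps)
    ultimately have "R n = (\<Sum>k<Suc n. g (\<tau> n (Suc k)) * y (\<tau> n (Suc k)) - g (\<tau> n k) * y (\<tau> n k)
        - g (\<tau> n k) * (w (\<tau> n (Suc k)) - w (\<tau> n k)))"
      unfolding R_def by (simp add: sum_subtractf)
    also have "\<dots> = (\<Sum>k<Suc n. integral {\<tau> n k..\<tau> n (Suc k)}
      (\<lambda>s. c * (g (\<tau> n k) * x s - g s * x (\<tau> n (Suc k)))))"
    proof (rule sum.cong[OF refl])
      fix k assume "k \<in> {..<Suc n}"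
      then have "y (\<tau> n k) = x (\<tau> n k)" "y (\<tau> n (Suc k)) = x (\<tau> n (Suc k))"
        using \<tau>[of k n] by (auto simp: y_def)
      then show "g (\<tau> n (Suc k)) * y (\<tau> n (Suc k)) - g (\<tau> n k) * y (\<tau> n k)
        - g (\<tau> n k) * (w (\<tau> n (Suc k)) - w (\<tau> n k)) = integral {\<tau> n k..\<tau> n (Suc k)}
          (\<lambda>s. c * (g (\<tau> n k) * x s - g s * x (\<tau> n (Suc k))))"
        using exp_sum_step[OF cont eq, of "\<tau> n k" "\<tau> n (Suc k)"] \<tau>[of k n] \<open>k \<in> {..<Suc n}\<close>
        by (simp add: g_def)
    qed
    finally show ?thesis .
  qed
  have "R \<longlonglongrightarrow> 0"
  proof (rule tendstoI)
    fix e0 :: real assume "e0 > 0"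
    \<comment> \<open>The integrand of \<open>exp_sum_step\<close> is at most \<open>\<bar>c\<bar> (B + G)\<close> times the oscillation; \<open>\<bar>c\<bar> + 1\<close> avoids dividing by \<open>0\<close>.\<close>
    define D where "D = (\<bar>c\<bar> + 1) * (B + G)"
    define e where "e = e0 / (2 * D)"
    have D: "D > 0"
      unfolding D_def using B G by (intro mult_pos_pos) auto
    then have "e > 0" and e: "D * e < e0"
      unfolding e_def using \<open>e0 > 0\<close> by (simp_all add: field_simps)
    obtain d1 where d1: "d1 > 0"
        "\<And>s t. s \<in> {a..a + 1} \<Longrightarrow> t \<in> {a..a + 1} \<Longrightarrow> dist t s < d1 \<Longrightarrow> dist (g t) (g s) < e"
      by (rule uniformly_continuous_onE[OF
            compact_uniformly_continuous[OF contg compact_Icc] \<open>e > 0\<close>]) blast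
    obtain d2 where d2: "d2 > 0"
        "\<And>s t. s \<in> {a..a + 1} \<Longrightarrow> t \<in> {a..a + 1} \<Longrightarrow> dist t s < d2 \<Longrightarrow> dist (y t) (y s) < e"
      by (rule uniformly_continuous_onE[OF
            compact_uniformly_continuous[OF conty compact_Icc] \<open>e > 0\<close>]) blast
    have small: "\<forall>\<^sub>F n in sequentially. 1 / real (n + 2) < min d1 d2"
    proof (rule order_tendstoD)
      show "(\<lambda>n. 1 / real (n + 2)) \<longlonglongrightarrow> 0"
        using LIMSEQ_ignore_initial_segment[OF lim_1_over_n, of 2] by simp
    qed (use d1 d2 in auto)
    show "\<forall>\<^sub>F n in sequentially. dist (R n) 0 < e0"
      using small
    proof eventually_elim
      case (elim n)
      have "\<bar>integral {\<tau> n k..\<tau> n (Suc k)} (\<lambda>s. c * (g (\<tau> n k) * x s - g s * x (\<tau> n (Suc k))))\<bar>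
          \<le> D * e / real (n + 2)" if k: "k < Suc n" for k
      proof -
        have "norm (integral {\<tau> n k..\<tau> n (Suc k)} (\<lambda>s. c * (g (\<tau> n k) * x s - g s * x (\<tau> n (Suc k)))))
          \<le> (D * e) * (\<tau> n (Suc k) - \<tau> n k)"
        proof (rule integral_bound)
          show "continuous_on {\<tau> n k..\<tau> n (Suc k)}
             (\<lambda>s. c * (g (\<tau> n k) * x s - g s * x (\<tau> n (Suc k))))"
            using \<tau>[OF k] unfolding g_def
            by (intro continuous_intros continuous_on_subset[OF cont]) auto
          fix s assume s: "s \<in> {\<tau> n k..\<tau> n (Suc k)}"
          let ?p = "\<tau> n k" and ?q = "\<tau> n (Suc k)"
          have mem: "s \<in> {a..a + 1}" "?p \<in> {a..a + 1}" "?q \<in> {a..a + 1}"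
            using s \<tau>[OF k] by auto
          have y: "x s = y s" "x ?q = y ?q"
            using s \<tau>[OF k] by (auto simp: y_def)
          have "\<bar>g ?p - g s\<bar> \<le> e"
            using d1(2)[OF mem(1,2)] s \<tau>[OF k] elim by (auto simp: dist_real_def)
          moreover have "\<bar>y s - y ?q\<bar> \<le> e"
            using d2(2)[OF mem(3,1)] s \<tau>[OF k] elim by (auto simp: dist_real_def)
          ultimately have "\<bar>(g ?p - g s) * y s + g s * (y s - y ?q)\<bar> \<le> e * B + G * e"
            using B(2)[OF mem(1)] G(2)[OF mem(1)] B(1) G(1)
            by (intro order_trans[OF abs_triangle_ineq] add_mono) (auto simp: abs_mult intro!: mult_mono)
          then have "\<bar>c\<bar> * \<bar>g ?p * x s - g s * x ?q\<bar> \<le> (\<bar>c\<bar> + 1) * ((B + G) * e)"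
            unfolding y by (intro mult_mono) (auto simp: algebra_simps)
          then show "norm (c * (g ?p * x s - g s * x ?q)) \<le> D * e"
            by (simp add: abs_mult mult.assoc D_def)
        qed (use \<tau>[OF k] in auto)
        then show ?thesis
          using \<tau>[OF k] by simp
      qed
      then have "\<bar>R n\<bar> \<le> (\<Sum>k<Suc n. D * e / real (n + 2))"
        unfolding Rsum by (intro order_trans[OF sum_abs] sum_mono) auto
      also have "\<dots> = (D * e) * (real (Suc n) / real (n + 2))"
        by simp
      also have "\<dots> \<le> (D * e) * 1"
        using D \<open>e > 0\<close> by (intro mult_left_mono) auto
      also have "\<dots> < e0"
        using e by simp
      finally show ?case
        by simp
    qed
  qed
  have "(\<lambda>n. 1 - 1 / real (n + 2)) \<longlonglongrightarrow> 1 - 0"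
    using LIMSEQ_ignore_initial_segment[OF lim_1_over_n, of 2] by (intro tendsto_intros) simp
  then have "(\<lambda>n. a + (1 - 1 / real (n + 2))) \<longlonglongrightarrow> a + 1"
    by (auto intro: tendsto_intros)
  moreover have "a + (1 - 1 / real (n + 2)) = \<tau> n (Suc n)" for n
    by (simp add: \<tau>_def field_simps)
  ultimately have lim\<tau>: "(\<lambda>n. \<tau> n (Suc n)) \<longlonglongrightarrow> a + 1"
    by simp
  have mem: "\<tau> n (Suc n) \<in> {a..a + 1}" for n
    using \<tau>[of n n] by auto
  have "(\<lambda>n. (g (\<tau> n (Suc n)) * y (\<tau> n (Suc n)) - g a * y a) - R n)
      \<longlonglongrightarrow> (g (a + 1) * y (a + 1) - g a * y a) - 0"
    using mem by (intro tendsto_intros \<open>R \<longlonglongrightarrow> 0\<close>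
      continuous_on_tendsto_compose[OF contg lim\<tau>] continuous_on_tendsto_compose[OF conty lim\<tau>]) auto
  then show ?thesis
    by (simp add: R_def g_def y_def)
qed

section \<open>Events and variables in the limit, and small-ball estimates\<close>

context prob_space
begin

text \<open>Fatou's lemma for events: \<open>B\<close> is almost surely contained in the increasing union of the sets
\<open>\<Inter>n\<ge>N. A n\<close>, each of which has probability at most \<open>p\<close>.\<close>

lemma prob_le_if_eventually:
  assumes [measurable]: "\<And>n. A n \<in> events" "B \<in> events"
    and ev: "AE \<omega> in M. \<omega> \<in> B \<longrightarrow> (\<forall>\<^sub>F n in sequentially. \<omega> \<in> A n)"
    and le: "\<And>n. prob (A n) \<le> p"
  shows "prob B \<le> p"
proof -
  define C where "C N = (\<Inter>n\<in>{N..}. A n)" for N :: nat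
  have [measurable]: "C N \<in> events" for N
    unfolding C_def by measurable
  have "(\<lambda>N. prob (C N)) \<longlonglongrightarrow> prob (\<Union>N. C N)"
    by (intro Lim_measure_incseq) (auto simp: incseq_def C_def)
  moreover have "prob (C N) \<le> p" for N
    using le[of N] by (intro order_trans[OF finite_measure_mono le[of N]]) (auto simp: C_def)
  ultimately have "prob (\<Union>N. C N) \<le> p"
    by (intro LIMSEQ_le_const2) auto
  moreover have "prob B \<le> prob (\<Union>N. C N)"
    using ev by (intro finite_measure_mono_AE) (auto simp: C_def eventually_sequentially)
  ultimately show ?thesis
    by simp
qed

text \<open>A linear bound on the Levy concentration function.  It says that the law has a density bounded by
\<open>K / 2\<close>, in a form that passes to sums and limits at once.\<close>

definition small_balls :: "real \<Rightarrow> ('a \<Rightarrow> real) \<Rightarrow> bool" where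
  "small_balls K X \<longleftrightarrow> (\<forall>x. \<forall>e>0. prob {\<omega> \<in> space M. \<bar>X \<omega> - x\<bar> < e} \<le> K * e)"

text \<open>Open intervals are used on purpose: if the limit lies in one, the approximating sequence
eventually does.\<close>

lemma small_balls_limit:
  assumes [measurable]: "\<And>n. random_variable borel (X n)" "random_variable borel Y"
    and lim: "AE \<omega> in M. (\<lambda>n. X n \<omega>) \<longlonglongrightarrow> Y \<omega>"
    and X: "\<And>n. small_balls K (X n)"
  shows "small_balls K Y"
  unfolding small_balls_def
proof (intro allI impI)
  fix x e :: real assume "e > 0"
  show "prob {\<omega> \<in> space M. \<bar>Y \<omega> - x\<bar> < e} \<le> K * e"
  proof (rule prob_le_if_eventually)
    show "AE \<omega> in M. \<omega> \<in> {\<omega> \<in> space M. \<bar>Y \<omega> - x\<bar> < e} \<longrightarrow>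
        (\<forall>\<^sub>F n in sequentially. \<omega> \<in> {\<omega> \<in> space M. \<bar>X n \<omega> - x\<bar> < e})"
      using lim
    proof eventually_elim
      case (elim \<omega>)
      have "(\<lambda>n. \<bar>X n \<omega> - x\<bar>) \<longlonglongrightarrow> \<bar>Y \<omega> - x\<bar>"
        by (intro tendsto_intros elim)
      then show ?case
        by (auto dest: order_tendstoD(2))
    qed
    show "prob {\<omega> \<in> space M. \<bar>X n \<omega> - x\<bar> < e} \<le> K * e" for n
      using X[of n] \<open>e > 0\<close> by (simp add: small_balls_def)
  qed measurable
qed

text \<open>Given the value of \<open>Y\<close>, the sum falls into an interval exactly if \<open>X\<close> falls into a translate of it, and
the bound for \<open>X\<close> is uniform over translates.\<close>

lemma small_balls_add_indep:
  assumes indep: "indep_var borel X borel Y" and X: "small_balls K X"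
  shows "small_balls K (\<lambda>\<omega>. X \<omega> + Y \<omega>)"
  unfolding small_balls_def
proof (intro allI impI)
  fix x e :: real assume "e > 0"
  have [measurable]: "random_variable borel X" "random_variable borel Y"
    and joint: "distr M borel X \<Otimes>\<^sub>M distr M borel Y = distr M (borel \<Otimes>\<^sub>M borel) (\<lambda>\<omega>. (X \<omega>, Y \<omega>))"
    using indep unfolding indep_var_distribution_eq by auto
  interpret X: prob_space "distr M borel X" by (rule prob_space_distr) measurable
  interpret Y: prob_space "distr M borel Y" by (rule prob_space_distr) measurable
  interpret XY: pair_sigma_finite "distr M borel X" "distr M borel Y" ..
  let ?A = "{p \<in> space (borel \<Otimes>\<^sub>M borel). \<bar>fst p + snd p - x\<bar> < e} :: (real \<times> real) set"
  have A: "?A \<in> sets (borel \<Otimes>\<^sub>M borel)"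
    by measurable
  have "emeasure M {\<omega> \<in> space M. \<bar>X \<omega> + Y \<omega> - x\<bar> < e} =
      emeasure (distr M (borel \<Otimes>\<^sub>M borel) (\<lambda>\<omega>. (X \<omega>, Y \<omega>))) ?A"
    by (subst emeasure_distr[OF _ A]) (auto intro!: arg_cong[where f="emeasure M"] simp: space_pair_measure)
  also have "\<dots> = (\<integral>\<^sup>+v. emeasure (distr M borel X) ((\<lambda>u. (u, v)) -` ?A) \<partial>distr M borel Y)"
    unfolding joint[symmetric] using A by (intro XY.emeasure_pair_measure_alt2) simp
  also have "\<dots> \<le> (\<integral>\<^sup>+v. ennreal (K * e) \<partial>distr M borel Y)"
  proof (rule nn_integral_mono)
    fix v
    have "emeasure (distr M borel X) ((\<lambda>u. (u, v)) -` ?A) =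
        emeasure M {\<omega> \<in> space M. \<bar>X \<omega> - (x - v)\<bar> < e}"
      using A by (subst emeasure_distr)
        (auto intro!: arg_cong[where f="emeasure M"] measurable_sets_borel simp: space_pair_measure algebra_simps)
    also have "\<dots> \<le> ennreal (K * e)"
      using X \<open>e > 0\<close> by (simp add: small_balls_def emeasure_eq_measure ennreal_leI)
    finally show "emeasure (distr M borel X) ((\<lambda>u. (u, v)) -` ?A) \<le> ennreal (K * e)" .
  qed
  also have "\<dots> = ennreal (K * e)"
    using Y.emeasure_space_1 by simp
  finally have *: "ennreal (prob {\<omega> \<in> space M. \<bar>X \<omega> + Y \<omega> - x\<bar> < e}) \<le> ennreal (K * e)"
    by (simp add: emeasure_eq_measure)
  have "0 \<le> K * e"
    using X \<open>e > 0\<close> order_trans[OF measure_nonneg] unfolding small_balls_def by blast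
  with * show "prob {\<omega> \<in> space M. \<bar>X \<omega> + Y \<omega> - x\<bar> < e} \<le> K * e"
    by simp
qed

lemma small_balls_cmult:
  assumes X: "small_balls K X" and c: "c > 0"
  shows "small_balls (K / c) (\<lambda>\<omega>. c * X \<omega>)"
  unfolding small_balls_def
proof (intro allI impI)
  fix x e :: real assume "e > 0"
  have "\<bar>c * X \<omega> - x\<bar> < e \<longleftrightarrow> \<bar>X \<omega> - x / c\<bar> < e / c" for \<omega>
  proof -
    have "\<bar>c * X \<omega> - x\<bar> = \<bar>c * (X \<omega> - x / c)\<bar>"
      using c by (simp add: algebra_simps)
    also have "\<dots> = c * \<bar>X \<omega> - x / c\<bar>"
      using c by (simp add: abs_mult)
    finally have "\<bar>c * X \<omega> - x\<bar> = c * \<bar>X \<omega> - x / c\<bar>" .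
    then show ?thesis
      using c by (simp add: field_simps)
  qed
  then show "prob {\<omega> \<in> space M. \<bar>c * X \<omega> - x\<bar> < e} \<le> K / c * e"
    using X[unfolded small_balls_def, rule_format, of "e / c" "x / c"] c \<open>e > 0\<close> by simp
qed

lemma small_balls_AE_nonzero:
  assumes [measurable]: "random_variable borel X" and X: "small_balls K X"
  shows "AE \<omega> in M. X \<omega> \<noteq> 0"
proof -
  have "prob {\<omega> \<in> space M. X \<omega> = 0} \<le> K * (1 / real (Suc n))" for n
  proof -
    have "prob {\<omega> \<in> space M. X \<omega> = 0} \<le> prob {\<omega> \<in> space M. \<bar>X \<omega> - 0\<bar> < 1 / real (Suc n)}"
      by (intro finite_measure_mono) auto
    also have "\<dots> \<le> K * (1 / real (Suc n))"
      using X unfolding small_balls_def by (metis of_nat_0_less_iff zero_less_Suc zero_less_divide_1_iff)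
    finally show ?thesis .
  qed
  moreover have "(\<lambda>n. K * (1 / real (Suc n))) \<longlonglongrightarrow> K * 0"
    using LIMSEQ_inverse_real_of_nat by (intro tendsto_intros) (simp add: inverse_eq_divide)
  ultimately have "prob {\<omega> \<in> space M. X \<omega> = 0} \<le> 0"
    by (intro LIMSEQ_le_const) auto
  then have "prob {\<omega> \<in> space M. X \<omega> = 0} = 0"
    by (simp add: measure_le_0_iff)
  then show ?thesis
    by (subst (asm) prob_eq_0) auto
qed

lemma small_balls_normal:
  assumes X: "distributed M lborel X (normal_density \<mu> s)" and s: "1 / 2 \<le> s\<^sup>2"
  shows "small_balls 2 X"
  unfolding small_balls_def
proof (intro allI impI)
  fix x e :: real assume "e > 0"
  have [measurable]: "random_variable borel X"
    using distributed_measurable[OF X] by simp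
  have dens: "normal_density \<mu> s y \<le> 1" for y
  proof -
    have "1 \<le> 2 * pi * s\<^sup>2"
      using mult_mono[of 2 "2 * pi" "1 / 2" "s\<^sup>2"] s pi_gt3 by simp
    then have "1 \<le> sqrt (2 * pi * s\<^sup>2)"
      by simp
    then have "1 / sqrt (2 * pi * s\<^sup>2) * exp (- (y - \<mu>)\<^sup>2 / (2 * s\<^sup>2)) \<le> 1 * 1"
      by (intro mult_mono) auto
    then show ?thesis
      by (simp add: normal_density_def)
  qed
  have "emeasure M {\<omega> \<in> space M. \<bar>X \<omega> - x\<bar> < e} = emeasure M (X -` {x - e<..<x + e} \<inter> space M)"
    by (intro arg_cong[where f="emeasure M"]) auto
  also have "\<dots> = (\<integral>\<^sup>+y. ennreal (normal_density \<mu> s y) * indicator {x - e<..<x + e} y \<partial>lborel)"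
    by (rule distributed_emeasure[OF X]) simp
  also have "\<dots> \<le> (\<integral>\<^sup>+y. indicator {x - e<..<x + e} y \<partial>lborel)"
    using dens by (intro nn_integral_mono) (auto simp: indicator_def)
  also have "\<dots> = ennreal (2 * e)"
    using \<open>e > 0\<close> by simp
  finally show "prob {\<omega> \<in> space M. \<bar>X \<omega> - x\<bar> < e} \<le> 2 * e"
    using \<open>e > 0\<close> by (simp add: emeasure_eq_measure)
qed

text \<open>An exponential Chebyshev bound.  Multiplying the density by \<open>exp y\<close> or \<open>exp (- y)\<close> shifts its mean by
\<open>s\<^sup>2\<close> and produces the factor \<open>exp (s\<^sup>2 / 2)\<close>.\<close>

lemma normal_tail_le:
  assumes X: "distributed M lborel X (normal_density 0 s)" and s: "s > 0"
  shows "prob {\<omega> \<in> space M. x < \<bar>X \<omega>\<bar>} \<le> 2 * exp (s\<^sup>2 / 2) * exp (- x)"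
proof -
  have [measurable]: "random_variable borel X"
    using distributed_measurable[OF X] by simp
  \<comment> \<open>Used for \<open>r = 1\<close> and \<open>r = - 1\<close>, one for each tail.\<close>
  have tilt: "normal_density 0 s y * exp (r * y) = exp (s\<^sup>2 / 2) * normal_density (r * s\<^sup>2) s y"
    if "r\<^sup>2 = 1" for r y
  proof -
    have "- (y - 0)\<^sup>2 / (2 * s\<^sup>2) + r * y = s\<^sup>2 / 2 + - (y - r * s\<^sup>2)\<^sup>2 / (2 * s\<^sup>2)"
    proof -
      have "(y - r * s\<^sup>2)\<^sup>2 = y\<^sup>2 - 2 * r * y * s\<^sup>2 + r\<^sup>2 * (s\<^sup>2)\<^sup>2"
        by (simp add: power2_eq_square algebra_simps)
      then show ?thesis
        using s that by (simp add: field_simps power2_eq_square)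
    qed
    then have "exp (- (y - 0)\<^sup>2 / (2 * s\<^sup>2)) * exp (r * y) =
        exp (s\<^sup>2 / 2) * exp (- (y - r * s\<^sup>2)\<^sup>2 / (2 * s\<^sup>2))"
      by (metis exp_add)
    then show ?thesis
      unfolding normal_density_def by (simp add: mult.left_commute)
  qed
  have one: "(\<integral>\<^sup>+y. ennreal (normal_density m s y) \<partial>lborel) = 1" for m
    using s by (subst nn_integral_eq_integral) auto
  have "emeasure M {\<omega> \<in> space M. x < \<bar>X \<omega>\<bar>} = emeasure M (X -` {y. x < \<bar>y\<bar>} \<inter> space M)"
    by (intro arg_cong[where f="emeasure M"]) auto
  also have "\<dots> = (\<integral>\<^sup>+y. ennreal (normal_density 0 s y) * indicator {y. x < \<bar>y\<bar>} y \<partial>lborel)"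
    by (rule distributed_emeasure[OF X]) measurable
  also have "\<dots> \<le> (\<integral>\<^sup>+y. ennreal (exp (s\<^sup>2 / 2) * exp (- x)) *
      (ennreal (normal_density (1 * s\<^sup>2) s y) + ennreal (normal_density (- 1 * s\<^sup>2) s y)) \<partial>lborel)"
  proof (rule nn_integral_mono)
    fix y
    have "normal_density 0 s y * indicator {y. x < \<bar>y\<bar>} y \<le>
        normal_density 0 s y * (exp (- x) * (exp (1 * y) + exp (- 1 * y)))"
    proof (intro mult_left_mono)
      have "1 \<le> exp (- x) * (exp y + exp (- y))" if "x < \<bar>y\<bar>"
      proof -
        have "1 \<le> exp (- x + \<bar>y\<bar>)"
          using that by simp
        also have "\<dots> \<le> exp (- x) * (exp y + exp (- y))"
          unfolding exp_add by (intro mult_left_mono) (auto simp: abs_if)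
        finally show ?thesis .
      qed
      then show "indicator {y. x < \<bar>y\<bar>} y \<le> exp (- x) * (exp (1 * y) + exp (- 1 * y))"
        by (auto simp: indicator_def)
    qed simp
    also have "\<dots> = exp (- x) * (normal_density 0 s y * exp (1 * y)) +
        exp (- x) * (normal_density 0 s y * exp (- 1 * y))"
      by (simp add: algebra_simps)
    also have "\<dots> = exp (s\<^sup>2 / 2) * exp (- x) *
        (normal_density (1 * s\<^sup>2) s y + normal_density (- 1 * s\<^sup>2) s y)"
      by (subst (1 2) tilt) (simp_all add: algebra_simps)
    finally show "ennreal (normal_density 0 s y) * indicator {y. x < \<bar>y\<bar>} y \<le>
        ennreal (exp (s\<^sup>2 / 2) * exp (- x)) *
        (ennreal (normal_density (1 * s\<^sup>2) s y) + ennreal (normal_density (- 1 * s\<^sup>2) s y))"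
      by (cases "x < \<bar>y\<bar>")
        (simp_all add: ennreal_mult[symmetric] ennreal_plus[symmetric] ennreal_leI del: ennreal_plus)
  qed
  also have "\<dots> = ennreal (exp (s\<^sup>2 / 2) * exp (- x)) * (1 + 1)"
    by (subst nn_integral_cmult, simp, subst nn_integral_add) (simp_all add: one)
  also have "\<dots> = ennreal (2 * exp (s\<^sup>2 / 2) * exp (- x))"
    by (simp add: ennreal_mult' mult_ac)
  finally show ?thesis
    by (simp add: emeasure_eq_measure)
qed

text \<open>By Tonelli, the other coordinates integrate to \<open>1\<close>.\<close>

lemma distributed_component_product_normal:
  fixes V :: "'a \<Rightarrow> real ^ 'd"
  assumes V: "distributed M lborel V (\<lambda>x. ennreal (\<Prod>k\<in>UNIV. normal_density 0 s (x $ k)))"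
    and s: "s > 0"
  shows "distributed M lborel (\<lambda>\<omega>. V \<omega> $ k) (normal_density 0 s)"
proof -
  have [measurable]: "V \<in> borel_measurable M"
    using distributed_measurable[OF V] by simp
  have [measurable]: "(\<lambda>x. x $ k) \<in> borel_measurable (borel :: (real ^ 'd) measure)"
    by (intro borel_measurable_continuous_onI continuous_intros)
  have one: "(\<integral>\<^sup>+y. ennreal (normal_density 0 s y) \<partial>lborel) = 1"
    using s by (subst nn_integral_eq_integral) auto
  have "distr M lborel (\<lambda>\<omega>. V \<omega> $ k) = density lborel (normal_density 0 s)"
  proof (rule measure_eqI)
    fix A :: "real set" assume "A \<in> sets (distr M lborel (\<lambda>\<omega>. V \<omega> $ k))"
    then have [measurable]: "A \<in> sets borel"
      by simp
    define f where "f v y = ennreal (normal_density 0 s y) *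
      (if v = axis k (1::real) then indicator A y else 1)" for v :: "real ^ 'd" and y
    have B: "(\<Prod>v\<in>Basis. h v) = (\<Prod>i\<in>UNIV. h (axis i 1))" for h :: "real ^ 'd \<Rightarrow> ennreal"
      by (subst prod.reindex[symmetric, of "\<lambda>i. axis i (1::real)", unfolded o_def])
        (auto simp: Basis_vec_def inj_on_def axis_eq_axis intro!: prod.cong)
    have "emeasure (distr M lborel (\<lambda>\<omega>. V \<omega> $ k)) A = emeasure M (V -` {x. x $ k \<in> A} \<inter> space M)"
      by (subst emeasure_distr) (auto intro!: arg_cong[where f="emeasure M"])
    also have "\<dots> = (\<integral>\<^sup>+x. ennreal (\<Prod>k\<in>UNIV. normal_density 0 s (x $ k)) *
        indicator {x. x $ k \<in> A} x \<partial>lborel)"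
      by (rule distributed_emeasure[OF V]) measurable
    also have "\<dots> = (\<integral>\<^sup>+x. (\<Prod>v\<in>Basis. f v (x \<bullet> v)) \<partial>lborel)"
    proof (rule nn_integral_cong)
      fix x :: "real ^ 'd"
      have "(\<Prod>v\<in>Basis. f v (x \<bullet> v)) = (\<Prod>i\<in>UNIV. f (axis i 1) (x $ i))"
        unfolding B by (simp add: inner_axis)
      also have "\<dots> = (\<Prod>i\<in>UNIV. ennreal (normal_density 0 s (x $ i))) *
          (\<Prod>i\<in>UNIV. if i = k then indicator A (x $ i) else 1)"
        unfolding f_def prod.distrib by (simp add: axis_eq_axis)
      finally show "ennreal (\<Prod>k\<in>UNIV. normal_density 0 s (x $ k)) *
          indicator {x. x $ k \<in> A} x = (\<Prod>v\<in>Basis. f v (x \<bullet> v))"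
        by (simp add: prod_ennreal prod.delta indicator_def)
    qed
    also have "\<dots> = (\<Prod>v\<in>Basis. \<integral>\<^sup>+y. f v y \<partial>lborel)"
      by (rule nn_integral_lborel_prod) (auto simp: f_def)
    also have "\<dots> = (\<Prod>i\<in>UNIV. if i = k then emeasure (density lborel (normal_density 0 s)) A else 1)"
      unfolding B by (rule prod.cong) (auto simp: f_def[abs_def] axis_eq_axis one emeasure_density)
    also have "\<dots> = emeasure (density lborel (normal_density 0 s)) A"
      by (simp add: prod.delta)
    finally show "emeasure (distr M lborel (\<lambda>\<omega>. V \<omega> $ k)) A =
      emeasure (density lborel (normal_density 0 s)) A" .
  qed simp
  then show ?thesis
    unfolding distributed_def by simp
qed

end

section \<open>Gaussian sums driven by a Brownian motion\<close>

text \<open>The variance of \<open>exp_sum c a w n\<close> for a one-dimensional Brownian path \<open>w\<close>, itself a Riemann sum of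
\<open>\<integral> exp (2 c (1 - s)) ds\<close> over \<open>[0, 1]\<close>.\<close>

definition exp_sum_var :: "real \<Rightarrow> nat \<Rightarrow> real" where
  "exp_sum_var c n = (\<Sum>k<Suc n. exp (2 * c * (1 - real k / real (n + 2))) / real (n + 2))"

lemma exp_sum_var_ge:
  assumes "c \<ge> 0"
  shows "1 / 2 \<le> exp_sum_var c n"
proof -
  have "1 / 2 \<le> (\<Sum>k<Suc n. 1 / real (n + 2))"
    by (simp add: field_simps)
  also have "\<dots> \<le> exp_sum_var c n"
    unfolding exp_sum_var_def
  proof (intro sum_mono divide_right_mono)
    fix k assume "k \<in> {..<Suc n}"
    then have "0 \<le> 1 - real k / real (n + 2)"
      by (simp add: field_simps)
    then show "1 \<le> exp (2 * c * (1 - real k / real (n + 2)))"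
      using assms by simp
  qed simp
  finally show ?thesis .
qed

lemma exp_sum_var_le: "exp_sum_var c n \<le> exp (2 * \<bar>c\<bar>)"
proof -
  have "exp_sum_var c n \<le> (\<Sum>k<Suc n. exp (2 * \<bar>c\<bar>) / real (n + 2))"
    unfolding exp_sum_var_def
  proof (intro sum_mono divide_right_mono)
    fix k assume "k \<in> {..<Suc n}"
    then have "c * (1 - real k / real (n + 2)) \<le> \<bar>c\<bar> * 1"
      by (intro order_trans[OF abs_ge_self[THEN mult_right_mono] mult_left_mono]) (auto simp: field_simps)
    then show "exp (2 * c * (1 - real k / real (n + 2))) \<le> exp (2 * \<bar>c\<bar>)"
      by (simp add: mult.assoc)
  qed simp
  also have "\<dots> = exp (2 * \<bar>c\<bar>) * (real (Suc n) / real (n + 2))"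
    by simp
  also have "\<dots> \<le> exp (2 * \<bar>c\<bar>) * 1"
    by (intro mult_left_mono) auto
  finally show ?thesis
    by simp
qed

lemma exp_sum_cmult: "exp_sum c a (\<lambda>t. r * w t) n = r * exp_sum c a w n"
  unfolding exp_sum_def sum_distrib_left by (simp add: algebra_simps)

lemma exp_sum_diff: "exp_sum c a (\<lambda>t. v t - w t) n = exp_sum c a v n - exp_sum c a w n"
  unfolding exp_sum_def sum_subtractf[symmetric] by (simp add: algebra_simps)

lemma exp_sum_sum: "exp_sum c a (\<lambda>t. \<Sum>i\<in>I. w i t) n = (\<Sum>i\<in>I. exp_sum c a (w i) n)"
  unfolding exp_sum_def
  by (subst sum.swap) (simp add: sum_subtractf[symmetric] sum_distrib_left)

context prob_space
begin

text \<open>The increments over the cells are independent centred Gaussians with variance \<open>1 / (n + 2)\<close>, and a linear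
combination of such variables is Gaussian.\<close>

lemma exp_sum_BM_normal:
  fixes W :: "real \<Rightarrow> 'a \<Rightarrow> real ^ 'd"
  assumes BM: "standard_BM_on M a (a + 1) W"
  shows "distributed M lborel (\<lambda>\<omega>. exp_sum c a (\<lambda>t. W t \<omega> $ k) n)
    (normal_density 0 (sqrt (exp_sum_var c n)))"
proof -
  define \<tau> where "\<tau> j = a + real j / real (n + 2)" for j :: nat
  have \<tau>: "\<tau> j \<in> {a..<a + 1}" if "j \<le> Suc n" for j
    using that by (auto simp: \<tau>_def field_simps)
  have \<tau>_less: "\<tau> j < \<tau> (Suc j)" for j
    by (simp add: \<tau>_def field_simps)
  have \<tau>_diff: "\<tau> (Suc j) - \<tau> j = 1 / real (n + 2)" for j
    by (simp add: \<tau>_def field_simps)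
  have nth: "(\<lambda>x. x $ k) \<in> borel_measurable (borel :: (real ^ 'd) measure)"
    by (intro borel_measurable_continuous_onI continuous_intros)
  define e where "e j = exp (c * (1 - real j / real (n + 2)))" for j :: nat
  define s where "s = sqrt (1 / real (n + 2))"
  have "indep_vars (\<lambda>_. borel) (\<lambda>j \<omega>. W (\<tau> (Suc j)) \<omega> - W (\<tau> j) \<omega>) {..<Suc n}"
    using BM \<tau> \<tau>_less unfolding standard_BM_on_def by blast
  then have indep: "indep_vars (\<lambda>_. borel)
      (\<lambda>j \<omega>. e j * ((W (\<tau> (Suc j)) \<omega> - W (\<tau> j) \<omega>) $ k)) {..<Suc n}"
    by (rule indep_vars_compose2) (intro borel_measurable_times borel_measurable_const nth)
  have inc: "distributed M lborel (\<lambda>\<omega>. e j * ((W (\<tau> (Suc j)) \<omega> - W (\<tau> j) \<omega>) $ k))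
      (normal_density 0 (e j * s))" if "j \<in> {..<Suc n}" for j
  proof -
    have "distributed M lborel (\<lambda>\<omega>. W (\<tau> (Suc j)) \<omega> - W (\<tau> j) \<omega>)
        (\<lambda>x. ennreal (\<Prod>k\<in>UNIV. normal_density 0 (sqrt (\<tau> (Suc j) - \<tau> j)) (x $ k)))"
      using BM \<tau>[of j] \<tau>[of "Suc j"] \<tau>_less[of j] that unfolding standard_BM_on_def by auto
    then have "distributed M lborel (\<lambda>\<omega>. (W (\<tau> (Suc j)) \<omega> - W (\<tau> j) \<omega>) $ k) (normal_density 0 s)"
      unfolding \<tau>_diff s_def by (rule distributed_component_product_normal) simp
    from normal_density_affine[OF this, of "e j" 0] show ?thesis
      by (simp add: e_def s_def)
  qed
  have "distributed M lborel (\<lambda>\<omega>. \<Sum>j<Suc n. e j * ((W (\<tau> (Suc j)) \<omega> - W (\<tau> j) \<omega>) $ k))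
      (normal_density (\<Sum>j<Suc n. 0) (sqrt (\<Sum>j<Suc n. (e j * s)\<^sup>2)))"
    by (rule sum_indep_normal[OF _ _ indep _ inc]) (auto simp: e_def s_def)
  moreover have "(\<Sum>j<Suc n. (e j * s)\<^sup>2) = exp_sum_var c n"
    unfolding exp_sum_var_def
    by (rule sum.cong) (auto simp: e_def s_def power_mult_distrib mult_ac simp flip: exp_double)
  moreover have "(\<lambda>\<omega>. \<Sum>j<Suc n. e j * ((W (\<tau> (Suc j)) \<omega> - W (\<tau> j) \<omega>) $ k)) =
      (\<lambda>\<omega>. exp_sum c a (\<lambda>t. W t \<omega> $ k) n)"
    by (simp add: exp_sum_def e_def \<tau>_def)
  ultimately show ?thesis
    by (simp only: sum.neutral_const)
qed

lemma exp_sum_BM_small_balls: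
  assumes BM: "standard_BM_on M a (a + 1) W" and c: "c \<ge> 0"
  shows "small_balls 2 (\<lambda>\<omega>. exp_sum c a (\<lambda>t. W t \<omega> $ k) n)"
  using exp_sum_var_ge[OF c, of n] by (intro small_balls_normal[OF exp_sum_BM_normal[OF BM]]) simp

lemma exp_sum_BM_tail:
  assumes BM: "standard_BM_on M a (a + 1) W"
  shows "prob {\<omega> \<in> space M. x < \<bar>exp_sum c a (\<lambda>t. W t \<omega> $ k) n\<bar>} \<le>
    2 * exp (exp (2 * \<bar>c\<bar>) / 2) * exp (- x)"
proof -
  have pos: "exp_sum_var c n > 0"
    unfolding exp_sum_var_def by (intro sum_pos) auto
  then have "prob {\<omega> \<in> space M. x < \<bar>exp_sum c a (\<lambda>t. W t \<omega> $ k) n\<bar>} \<le>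
      2 * exp ((sqrt (exp_sum_var c n))\<^sup>2 / 2) * exp (- x)"
    by (intro normal_tail_le exp_sum_BM_normal[OF BM]) simp
  also have "\<dots> \<le> 2 * exp (exp (2 * \<bar>c\<bar>) / 2) * exp (- x)"
    using pos exp_sum_var_le[of c n] by simp
  finally show ?thesis .
qed

text \<open>Brings the independence of two generated sigma-fields into the form needed for random variables
that are measurable with respect to them.\<close>

lemma indep_var_of_indep_set:
  assumes indep: "indep_set (sets F) (sets G)"
    and sp: "space F = space M" "space G = space M"
    and X: "X \<in> measurable F S" and Y: "Y \<in> measurable G T"
  shows "indep_var S X T Y"
proof -
  have ev: "sets F \<subseteq> events" "sets G \<subseteq> events"
    using indep unfolding indep_sets2_eq by auto
  have "sigma_sets (space M) {X -` A \<inter> space M |A. A \<in> sets S} \<subseteq> sets F"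
    using measurable_sets[OF X] unfolding sp(1)[symmetric] by (intro sets.sigma_sets_subset) auto
  moreover have "sigma_sets (space M) {Y -` A \<inter> space M |A. A \<in> sets T} \<subseteq> sets G"
    using measurable_sets[OF Y] unfolding sp(2)[symmetric] by (intro sets.sigma_sets_subset) auto
  moreover have "X \<in> measurable M S" "Y \<in> measurable M T"
    using X Y ev sp by (auto intro: measurable_from_subalg simp: subalgebra_def)
  ultimately show ?thesis
    using indep ev unfolding indep_var_eq indep_sets2_eq by blast
qed

end

lemma measurable_sigma_field_coordinate:
  assumes "k \<in> K"
  shows "X k \<in> borel_measurable (vimage_algebra \<Omega> (\<lambda>\<omega>. \<lambda>k\<in>K. X k \<omega>) (PiM K (\<lambda>_. borel)))"
proof -
  have "(\<lambda>\<omega>. (\<lambda>k\<in>K. X k \<omega>) k) \<in> borel_measurable (vimage_algebra \<Omega> (\<lambda>\<omega>. \<lambda>k\<in>K. X k \<omega>) (PiM K (\<lambda>_. borel)))"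
    using assms by (intro measurable_compose[OF measurable_vimage_algebra1 measurable_component_singleton])
      (auto simp: space_PiM)
  then show ?thesis
    using assms by simp
qed

section \<open>Pathwise analysis of one generation\<close>

text \<open>One unit of time in one coordinate: \<open>z\<close> are the paths, \<open>w\<close> the driving noises, \<open>p\<close> the parent map and
\<open>zn\<close> the positions of the offspring.  Averaging the equations cancels the interaction, which leaves the
rate \<open>- b\<close>; subtracting the average from one equation leaves the rate \<open>- b - \<gamma>\<close>.  Branching does not
change the average since every particle has the same number of offspring.  The left limits of all
paths exist because every particle has a child, which is born there.\<close>

lemma generation_step:
  fixes z w :: "nat \<Rightarrow> real \<Rightarrow> real" and zn :: "nat \<Rightarrow> real" and p :: "nat \<Rightarrow> nat"
  assumes cont: "\<And>i. i \<in> {1..2 ^ m} \<Longrightarrow> continuous_on {a..<a + 1} (z i)"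
    and par: "\<And>i. i \<in> {1..2 ^ Suc m} \<Longrightarrow> p i \<in> {1..2 ^ m}"
    and two: "\<And>j. j \<in> {1..2 ^ m} \<Longrightarrow> card {i \<in> {1..2 ^ Suc m}. p i = j} = 2"
    and left: "\<And>i. i \<in> {1..2 ^ Suc m} \<Longrightarrow> (z (p i) \<longlongrightarrow> zn i) (at_left (a + 1))"
    and sde: "\<And>i t. i \<in> {1..2 ^ m} \<Longrightarrow> t \<in> {a..<a + 1} \<Longrightarrow>
      z i t = z i a + (w i t - w i a) +
        integral {a..t} (\<lambda>s. - b * z i s + (1 / 2 ^ m) * (\<Sum>j=1..2 ^ m. \<gamma> * (z j s - z i s)))"
  defines "mean \<equiv> \<lambda>t. (\<Sum>j=1..2 ^ m. z j t) / 2 ^ m"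
    and "mean_next \<equiv> (\<Sum>i=1..2 ^ Suc m. zn i) / 2 ^ Suc m"
    and "mean_noise \<equiv> \<lambda>c n. (\<Sum>j=1..2 ^ m. exp_sum c a (w j) n) / 2 ^ m"
  shows "mean_noise (- b) \<longlonglongrightarrow> mean_next - exp (- b) * mean a"
    and "\<And>i. i \<in> {1..2 ^ Suc m} \<Longrightarrow>
      (\<lambda>n. exp_sum (- b - \<gamma>) a (w (p i)) n - mean_noise (- b - \<gamma>) n)
        \<longlonglongrightarrow> (zn i - mean_next) - exp (- b - \<gamma>) * (z (p i) a - mean a)"
proof -
  let ?J = "{1..2 ^ m} :: nat set" and ?I = "{1..2 ^ Suc m} :: nat set"
  have "\<exists>l. (z j \<longlongrightarrow> l) (at_left (a + 1))" if "j \<in> ?J" for j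
  proof -
    have "{i \<in> ?I. p i = j} \<noteq> {}"
      using two[OF that] by (metis card.empty zero_neq_numeral)
    then show ?thesis
      using left by blast
  qed
  then obtain l where l: "\<And>j. j \<in> ?J \<Longrightarrow> (z j \<longlongrightarrow> l j) (at_left (a + 1))"
    by metis
  have zn: "zn i = l (p i)" if "i \<in> ?I" for i
    using tendsto_unique[OF trivial_limit_at_left_real left[OF that] l[OF par[OF that]]] .
  have "(\<Sum>i\<in>?I. zn i) = (\<Sum>i\<in>?I. l (p i))"
    by (intro sum.cong zn refl)
  also have "\<dots> = (\<Sum>j\<in>?J. of_nat (card {i \<in> ?I. p i = j}) * l j)"
    using par by (intro sum_fun_comp) auto
  also have "\<dots> = (\<Sum>j\<in>?J. 2 * l j)"
    using two by (intro sum.cong) auto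
  finally have mean_next: "mean_next = (\<Sum>j\<in>?J. l j) / 2 ^ m"
    unfolding mean_next_def by (simp add: sum_distrib_left[symmetric])
  have mean_left: "(mean \<longlongrightarrow> mean_next) (at_left (a + 1))"
    unfolding mean_next mean_def by (intro tendsto_intros l) auto
  have mean_cont: "continuous_on {a..<a + 1} mean"
    unfolding mean_def by (intro continuous_intros cont) auto
  define f where "f i s = (- b - \<gamma>) * z i s + \<gamma> * mean s" for i s
  have drift: "- b * z i s + (1 / 2 ^ m) * (\<Sum>j=1..2 ^ m. \<gamma> * (z j s - z i s)) = f i s" for i s
    unfolding f_def mean_def sum_distrib_left[symmetric]
    by (simp add: sum_subtractf field_simps)
  have mean_f: "(\<Sum>i\<in>?J. f i s) / 2 ^ m = - b * mean s" for s
  proof -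
    have "(\<Sum>i\<in>?J. f i s) = (- b - \<gamma>) * (\<Sum>i\<in>?J. z i s) + 2 ^ m * (\<gamma> * mean s)"
      unfolding f_def sum.distrib sum_distrib_left[symmetric] by simp
    also have "(\<Sum>i\<in>?J. z i s) = 2 ^ m * mean s"
      unfolding mean_def by simp
    finally show ?thesis
      by (simp add: field_simps)
  qed
  have int_f: "f i integrable_on {a..t}" if "i \<in> ?J" "t \<in> {a..<a + 1}" for i t
    unfolding f_def using that
    by (intro integrable_continuous_interval continuous_intros
        continuous_on_subset[OF cont] continuous_on_subset[OF mean_cont]) auto
  have int_mean: "(\<lambda>s. - b * mean s) integrable_on {a..t}" if "t \<in> {a..<a + 1}" for t
    using that by (intro integrable_continuous_interval continuous_intros
        continuous_on_subset[OF mean_cont]) auto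
  have eq: "z i t = z i a + (w i t - w i a) + integral {a..t} (f i)"
    if "i \<in> ?J" "t \<in> {a..<a + 1}" for i t
    using sde[OF that] unfolding drift .
  define wm where "wm t = (\<Sum>j\<in>?J. w j t) / 2 ^ m" for t
  have mean_eq: "mean t = mean a + (wm t - wm a) + integral {a..t} (\<lambda>s. - b * mean s)"
    if t: "t \<in> {a..<a + 1}" for t
  proof -
    have "(\<Sum>j\<in>?J. z j t) = (\<Sum>j\<in>?J. z j a + (w j t - w j a) + integral {a..t} (f j))"
      using eq t by (intro sum.cong refl) blast
    also have "\<dots> = (\<Sum>j\<in>?J. z j a) + ((\<Sum>j\<in>?J. w j t) - (\<Sum>j\<in>?J. w j a)) +
        integral {a..t} (\<lambda>s. \<Sum>j\<in>?J. f j s)"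
      using int_f t by (subst integral_sum) (auto simp: sum.distrib sum_subtractf)
    finally have "mean t = mean a + (wm t - wm a) + integral {a..t} (\<lambda>s. \<Sum>j\<in>?J. f j s) / 2 ^ m"
      unfolding mean_def wm_def by (simp add: field_simps)
    also have "integral {a..t} (\<lambda>s. \<Sum>j\<in>?J. f j s) / 2 ^ m = integral {a..t} (\<lambda>s. (\<Sum>j\<in>?J. f j s) / 2 ^ m)"
      by simp
    finally show ?thesis
      unfolding mean_f .
  qed
  have noise: "exp_sum c a wm = mean_noise c" for c
    unfolding wm_def mean_noise_def divide_inverse
    by (subst (1 2) mult.commute) (auto simp: exp_sum_cmult exp_sum_sum)
  show "mean_noise (- b) \<longlonglongrightarrow> mean_next - exp (- b) * mean a"
    unfolding noise[symmetric] by (rule exp_sum_tendsto[OF mean_cont mean_left mean_eq])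
  fix i assume i: "i \<in> ?I"
  note j = par[OF i]
  have "exp_sum (- b - \<gamma>) a (\<lambda>t. w (p i) t - wm t) \<longlonglongrightarrow>
      (l (p i) - mean_next) - exp (- b - \<gamma>) * (z (p i) a - mean a)"
  proof (rule exp_sum_tendsto)
    show "continuous_on {a..<a + 1} (\<lambda>t. z (p i) t - mean t)"
      by (intro continuous_intros cont mean_cont j)
    show "((\<lambda>t. z (p i) t - mean t) \<longlongrightarrow> l (p i) - mean_next) (at_left (a + 1))"
      by (intro tendsto_intros l mean_left j)
    fix t assume t: "t \<in> {a..<a + 1}"
    have "integral {a..t} (\<lambda>s. (- b - \<gamma>) * (z (p i) s - mean s)) =
        integral {a..t} (\<lambda>s. f (p i) s - - b * mean s)"
      by (rule arg_cong[where f="integral {a..t}"]) (auto simp: f_def algebra_simps)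
    also have "\<dots> = integral {a..t} (f (p i)) - integral {a..t} (\<lambda>s. - b * mean s)"
      by (rule Henstock_Kurzweil_Integration.integral_diff[OF int_f[OF j t] int_mean[OF t]])
    finally show "z (p i) t - mean t = z (p i) a - mean a + (w (p i) t - wm t - (w (p i) a - wm a)) +
        integral {a..t} (\<lambda>s. (- b - \<gamma>) * (z (p i) s - mean s))"
      using eq[OF j t] mean_eq[OF t] by linarith
  qed
  then show "(\<lambda>n. exp_sum (- b - \<gamma>) a (w (p i)) n - mean_noise (- b - \<gamma>) n)
        \<longlonglongrightarrow> (zn i - mean_next) - exp (- b - \<gamma>) * (z (p i) a - mean a)"
    unfolding zn[OF i] noise[symmetric] exp_sum_diff[symmetric] .
qed

text \<open>The noise bounds below are available only for infinitely many approximating sums, not for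
eventually all of them; for the limit this makes no difference.\<close>

lemma limit_le_if_frequently_le:
  fixes x :: "nat \<Rightarrow> real"
  assumes "x \<longlonglongrightarrow> l" and "\<exists>\<^sub>F n in sequentially. \<bar>x n\<bar> \<le> C"
  shows "\<bar>l\<bar> \<le> C"
proof (rule ccontr)
  assume "\<not> \<bar>l\<bar> \<le> C"
  moreover have "(\<lambda>n. \<bar>x n\<bar>) \<longlonglongrightarrow> \<bar>l\<bar>"
    using assms(1) by (rule tendsto_rabs)
  ultimately have "\<forall>\<^sub>F n in sequentially. C < \<bar>x n\<bar>"
    by (intro order_tendstoD(1)) auto
  then show False
    using assms(2) by (simp add: frequently_def not_le)
qed

text \<open>Once \<open>e m \<le> (1 - q) d / 2\<close>, the recursion keeps \<open>r\<close> below a sequence that converges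
geometrically to the fixed point \<open>d / 2\<close> of \<open>x \<mapsto> q x + (1 - q) d / 2\<close>.\<close>

lemma contraction_with_vanishing_error:
  fixes r e :: "nat \<Rightarrow> real"
  assumes q: "0 \<le> q" "q < 1" and r: "\<And>m. 0 \<le> r m"
    and step: "\<forall>\<^sub>F m in sequentially. r (Suc m) \<le> q * r m + e m"
    and e: "e \<longlonglongrightarrow> 0"
  shows "r \<longlonglongrightarrow> 0"
proof (rule order_tendstoI)
  fix d :: real assume "0 < d"
  have "0 < (1 - q) * (d / 2)"
    using q \<open>0 < d\<close> by simp
  then have "\<forall>\<^sub>F m in sequentially. e m < (1 - q) * (d / 2)"
    using e by (rule order_tendstoD(2)[rotated])
  with step have "\<forall>\<^sub>F m in sequentially. r (Suc m) \<le> q * r m + (1 - q) * (d / 2)"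
    by eventually_elim auto
  then obtain M where M: "\<And>m. m \<ge> M \<Longrightarrow> r (Suc m) \<le> q * r m + (1 - q) * (d / 2)"
    unfolding eventually_sequentially by auto
  have bound: "r (j + M) \<le> q ^ j * r M + d / 2" for j
  proof (induction j)
    case 0
    then show ?case using \<open>0 < d\<close> by simp
  next
    case (Suc j)
    have "r (Suc j + M) \<le> q * r (j + M) + (1 - q) * (d / 2)"
      using M[of "j + M"] by simp
    also have "\<dots> \<le> q * (q ^ j * r M + d / 2) + (1 - q) * (d / 2)"
      using Suc q by (intro add_mono mult_left_mono) auto
    also have "\<dots> = q ^ Suc j * r M + d / 2"
      by (simp add: field_simps)
    finally show ?case .
  qed
  have "(\<lambda>j. q ^ j * r M + d / 2) \<longlonglongrightarrow> 0 * r M + d / 2"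
    using q by (intro tendsto_intros LIMSEQ_power_zero) auto
  then have "\<forall>\<^sub>F j in sequentially. q ^ j * r M + d / 2 < d"
    by (rule order_tendstoD(2)) (use \<open>0 < d\<close> in simp)
  then have "\<forall>\<^sub>F j in sequentially. r (j + M) < d"
    by eventually_elim (use bound in \<open>auto intro: le_less_trans\<close>)
  then show "\<forall>\<^sub>F m in sequentially. r m < d"
    by (rule iffD1[OF eventually_sequentially_seg[of "\<lambda>m. r m < d" M]])
next
  show "\<forall>\<^sub>F m in sequentially. d < r m" if "d < 0" for d
    using that r by (auto intro!: always_eventually intro: less_le_trans)
qed

section \<open>The average and the deviations from it\<close>

lemma alive_of_nat: "alive (real m) = {1..2 ^ m}"
  by (simp add: alive_def)

context interacting_branching_diffusion
begin

text \<open>All quantities below are taken in the coordinate \<open>k\<close>; the escape of a single coordinate is enough for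
the escape of a particle.\<close>

definition noise :: "'d \<Rightarrow> real \<Rightarrow> nat \<Rightarrow> nat \<Rightarrow> nat \<Rightarrow> 'w \<Rightarrow> real" where
  "noise k c m i n \<omega> = exp_sum c (real m) (\<lambda>t. W m i t \<omega> $ k) n"

definition mean_noise :: "'d \<Rightarrow> real \<Rightarrow> nat \<Rightarrow> nat \<Rightarrow> 'w \<Rightarrow> real" where
  "mean_noise k c m n \<omega> = (\<Sum>j=1..2 ^ m. noise k c m j n \<omega>) / 2 ^ m"

definition mean :: "'d \<Rightarrow> nat \<Rightarrow> 'w \<Rightarrow> real" where
  "mean k m \<omega> = (\<Sum>j=1..2 ^ m. Z (real m) j \<omega> $ k) / 2 ^ m"

lemma AE_generation_step:
  "AE \<omega> in M. \<forall>m.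
     (\<lambda>n. mean_noise k (- b) m n \<omega>) \<longlonglongrightarrow> mean k (Suc m) \<omega> - exp (- b) * mean k m \<omega> \<and>
     (\<forall>i\<in>{1..2 ^ Suc m}. par m i \<omega> \<in> {1..2 ^ m} \<and>
       (\<lambda>n. noise k (- b - \<gamma>) m (par m i \<omega>) n \<omega> - mean_noise k (- b - \<gamma>) m n \<omega>)
         \<longlonglongrightarrow> (Z (real (Suc m)) i \<omega> $ k - mean k (Suc m) \<omega>) -
             exp (- b - \<gamma>) * (Z (real m) (par m i \<omega>) \<omega> $ k - mean k m \<omega>))"
  using two_offspring born_at_parent continuous_Z SDE
proof eventually_elim
  case (elim \<omega>)
  show ?case
  proof
    fix m
    let ?z = "\<lambda>i t. Z t i \<omega> $ k" and ?w = "\<lambda>i t. W m i t \<omega> $ k"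
    let ?zn = "\<lambda>i. Z (real (Suc m)) i \<omega> $ k" and ?p = "\<lambda>i. par m i \<omega>"
    have cont: "continuous_on {real m..<real m + 1} (\<lambda>t. Z t i \<omega>)" if "i \<in> {1..2 ^ m}" for i
      using elim(3) that by blast
    have 1: "continuous_on {real m..<real m + 1} (?z i)" if "i \<in> {1..2 ^ m}" for i
      using cont[OF that] by (rule continuous_on_component)
    have 2: "?p i \<in> {1..2 ^ m}" if "i \<in> {1..2 ^ Suc m}" for i
      using elim(1) that by blast
    have 3: "card {i \<in> {1..2 ^ Suc m}. ?p i = j} = 2" if "j \<in> {1..2 ^ m}" for j
      using elim(1) that by blast
    have 4: "(?z (?p i) \<longlongrightarrow> ?zn i) (at_left (real m + 1))" if "i \<in> {1..2 ^ Suc m}" for i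
      using elim(2) that by (auto intro!: tendsto_vec_nth simp: add.commute)
    have 5: "?z i t = ?z i (real m) + (?w i t - ?w i (real m)) +
        integral {real m..t} (\<lambda>s. - b * ?z i s + (1 / 2 ^ m) * (\<Sum>j=1..2 ^ m. \<gamma> * (?z j s - ?z i s)))"
      if i: "i \<in> {1..2 ^ m}" and t: "t \<in> {real m..<real m + 1}" for i t
    proof -
      let ?f = "\<lambda>s. - b *\<^sub>R Z s i \<omega> + (1 / 2 ^ m) *\<^sub>R (\<Sum>j=1..2 ^ m. \<gamma> *\<^sub>R (Z s j \<omega> - Z s i \<omega>))"
      have "?f integrable_on {real m..t}"
        using i t by (intro integrable_continuous_interval continuous_intros
            continuous_on_subset[OF cont]) auto
      then have "integral {real m..t} ?f $ k = integral {real m..t} (\<lambda>s. ?f s $ k)"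
        by (rule integral_component_eq_cart[symmetric])
      moreover have "Z t i \<omega> $ k = (Z (real m) i \<omega> + (W m i t \<omega> - W m i (real m) \<omega>)
           + integral {real m..t} ?f) $ k"
        using elim(4) i t by (intro arg_cong[where f="\<lambda>x. x $ k"]) blast
      ultimately show ?thesis
        by simp
    qed
    have "(\<lambda>n. mean_noise k (- b) m n \<omega>) \<longlonglongrightarrow> mean k (Suc m) \<omega> - exp (- b) * mean k m \<omega>"
      unfolding mean_noise_def noise_def mean_def
      by (rule generation_step(1)[where z = ?z and p = ?p and zn = ?zn and \<gamma> = \<gamma>]) (fact 1 2 3 4 5)+
    moreover have "?p i \<in> {1..2 ^ m} \<and>
       (\<lambda>n. noise k (- b - \<gamma>) m (?p i) n \<omega> - mean_noise k (- b - \<gamma>) m n \<omega>)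
         \<longlonglongrightarrow> (?zn i - mean k (Suc m) \<omega>) -
             exp (- b - \<gamma>) * (?z (?p i) (real m) - mean k m \<omega>)" if i: "i \<in> {1..2 ^ Suc m}" for i
      unfolding mean_noise_def noise_def mean_def
      by (rule conjI[OF 2[OF i]], rule generation_step(2)[where z = ?z and p = ?p and zn = ?zn
          and w = ?w and b = b]) (fact 1 2 3 4 5 i)+
    ultimately show "(\<lambda>n. mean_noise k (- b) m n \<omega>) \<longlonglongrightarrow> mean k (Suc m) \<omega> - exp (- b) * mean k m \<omega> \<and>
     (\<forall>i\<in>{1..2 ^ Suc m}. ?p i \<in> {1..2 ^ m} \<and>
       (\<lambda>n. noise k (- b - \<gamma>) m (?p i) n \<omega> - mean_noise k (- b - \<gamma>) m n \<omega>)
         \<longlonglongrightarrow> (?zn i - mean k (Suc m) \<omega>) -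
             exp (- b - \<gamma>) * (?z (?p i) (real m) - mean k m \<omega>))"
      by blast
  qed
qed

lemma measurable_noise [measurable]:
  "i \<in> {1..2 ^ m} \<Longrightarrow> random_variable borel (noise k c m i n)"
  using distributed_measurable[OF exp_sum_BM_normal[OF BM]] unfolding noise_def by simp

lemma measurable_mean_noise [measurable]: "random_variable borel (mean_noise k c m n)"
  unfolding mean_noise_def by (intro borel_measurable_divide borel_measurable_sum) auto

lemma measurable_vec_nth: "(\<lambda>x :: real ^ 'd. x $ k) \<in> borel_measurable borel"
  by (intro borel_measurable_continuous_onI continuous_intros)

lemma measurable_mean [measurable]: "random_variable borel (mean k m)"
  unfolding mean_def
  by (intro borel_measurable_divide borel_measurable_sum measurable_compose[OF measurable_Z measurable_vec_nth])
    (auto simp: alive_of_nat)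

text \<open>Let \<open>E m n\<close> be the event that the \<open>n\<close>-th sum of some particle of generation \<open>m\<close> exceeds \<open>2 m\<close> in modulus.  The
union bound and the Gaussian tail give \<open>prob (E m n) \<le> K (2 exp (- 2)) ^ m\<close> for every \<open>n\<close>, so the
event that \<open>E m n\<close> holds for all large \<open>n\<close> has the same bound.  This is summable in \<open>m\<close>, and the
level \<open>2 m\<close> is chosen for that: \<open>exp (- 2 m)\<close> outweighs the number \<open>2 ^ m\<close> of particles.\<close>

lemma AE_noise_bound:
  "AE \<omega> in M. \<forall>\<^sub>F m in sequentially. \<exists>\<^sub>F n in sequentially.
     \<forall>j\<in>{1..2 ^ m}. \<bar>noise k c m j n \<omega>\<bar> \<le> 2 * real m"
proof -
  define K where "K = 2 * exp (exp (2 * \<bar>c\<bar>) / 2)"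
  define E where "E m n = (\<Union>j\<in>{1..2 ^ m}. {\<omega> \<in> space M. 2 * real m < \<bar>noise k c m j n \<omega>\<bar>})" for m n
  define B where "B m = (\<Union>N. \<Inter>n\<in>{N..}. E m n)" for m
  have [measurable]: "E m n \<in> events" for m n
    unfolding E_def by (intro sets.finite_UN) auto
  have [measurable]: "B m \<in> events" for m
    unfolding B_def by measurable
  have E_le: "prob (E m n) \<le> K * (2 * exp (- 2)) ^ m" for m n
  proof -
    have "prob (E m n) \<le> (\<Sum>j\<in>{1..2 ^ m}. prob {\<omega> \<in> space M. 2 * real m < \<bar>noise k c m j n \<omega>\<bar>})"
      unfolding E_def by (intro finite_measure_subadditive_finite) auto
    also have "\<dots> \<le> (\<Sum>j\<in>{1..2 ^ m :: nat}. K * exp (- (2 * real m)))"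
      unfolding K_def noise_def by (intro sum_mono exp_sum_BM_tail BM)
    also have "\<dots> = K * (2 ^ m * exp (real m * (- 2)))"
      by (simp add: mult.commute)
    also have "\<dots> = K * (2 * exp (- 2)) ^ m"
      unfolding exp_of_nat_mult power_mult_distrib ..
    finally show ?thesis .
  qed
  have B_le: "prob (B m) \<le> K * (2 * exp (- 2)) ^ m" for m
  proof (rule prob_le_if_eventually[of "E m"])
    show "AE \<omega> in M. \<omega> \<in> B m \<longrightarrow> (\<forall>\<^sub>F n in sequentially. \<omega> \<in> E m n)"
      by (rule AE_I2) (auto simp: B_def eventually_sequentially)
  qed (use E_le in auto)
  have "2 * exp (- 2 :: real) < 1"
    using exp_ge_add_one_self[of 2] by (simp add: exp_minus field_simps)
  then have "summable (\<lambda>m. K * (2 * exp (- 2)) ^ m)"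
    by (intro summable_mult summable_geometric) simp
  then have "summable (\<lambda>m. prob (B m))"
    by (rule summable_comparison_test') (simp only: real_norm_def abs_of_nonneg measure_nonneg B_le)
  then have "AE \<omega> in M. \<forall>\<^sub>F m in sequentially. \<omega> \<in> space M - B m"
    by (intro borel_cantelli_AE1) (auto simp: emeasure_eq_measure)
  then show ?thesis
  proof eventually_elim
    case (elim \<omega>)
    then show ?case
    proof eventually_elim
      case (elim m)
      then have "\<exists>\<^sub>F n in sequentially. \<omega> \<notin> E m n"
        by (auto simp: B_def frequently_def eventually_sequentially)
      then show ?case
        by (rule frequently_elim1) (use elim in \<open>auto simp: E_def not_less\<close>)
    qed
  qed
qed

lemma abs_mean_noise_le:
  assumes "\<forall>j\<in>{1..2 ^ m}. \<bar>noise k c m j n \<omega>\<bar> \<le> C"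
  shows "\<bar>mean_noise k c m n \<omega>\<bar> \<le> C"
proof -
  have "\<bar>\<Sum>j=1..2 ^ m. noise k c m j n \<omega>\<bar> \<le> (\<Sum>j=1..2 ^ m :: nat. C)"
    using assms by (intro order_trans[OF sum_abs] sum_mono) auto
  then show ?thesis
    by (simp add: mean_noise_def field_simps)
qed

text \<open>The left-hand side is the limit of the average noises of the generation, so it inherits the bound
on the individual noises.\<close>

lemma AE_mean_step_bound:
  "AE \<omega> in M. \<forall>\<^sub>F m in sequentially. \<bar>mean k (Suc m) \<omega> - exp (- b) * mean k m \<omega>\<bar> \<le> 2 * real m"
  using AE_generation_step[of k] AE_noise_bound[of k "- b"]
proof eventually_elim
  case (elim \<omega>)
  from elim(2) show ?case
  proof eventually_elim
    case (elim m)
    then have "\<exists>\<^sub>F n in sequentially. \<bar>mean_noise k (- b) m n \<omega>\<bar> \<le> 2 * real m"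
      by (rule frequently_elim1) (rule abs_mean_noise_le)
    with \<open>\<forall>m. _ m\<close> show ?case
      by (blast intro: limit_le_if_frequently_le)
  qed
qed

text \<open>The limiting noise is a difference of an individual noise and an average noise, each bounded by
\<open>2 m\<close>.\<close>

lemma AE_deviation_step_bound:
  "AE \<omega> in M. \<forall>\<^sub>F m in sequentially. \<forall>i\<in>{1..2 ^ Suc m}. par m i \<omega> \<in> {1..2 ^ m} \<and>
     \<bar>(Z (real (Suc m)) i \<omega> $ k - mean k (Suc m) \<omega>) -
        exp (- b - \<gamma>) * (Z (real m) (par m i \<omega>) \<omega> $ k - mean k m \<omega>)\<bar> \<le> 4 * real m"
  using AE_generation_step[of k] AE_noise_bound[of k "- b - \<gamma>"]
proof eventually_elim
  case (elim \<omega>)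
  note step = elim(1)
  from elim(2) show ?case
  proof eventually_elim
    case (elim m)
    show ?case
    proof
      fix i :: nat assume i: "i \<in> {1..2 ^ Suc m}"
      then have p: "par m i \<omega> \<in> {1..2 ^ m}"
        using step by blast
      have "\<exists>\<^sub>F n in sequentially.
          \<bar>noise k (- b - \<gamma>) m (par m i \<omega>) n \<omega> - mean_noise k (- b - \<gamma>) m n \<omega>\<bar> \<le> 4 * real m"
        using elim
      proof (rule frequently_elim1)
        fix n assume n: "\<forall>j\<in>{1..2 ^ m}. \<bar>noise k (- b - \<gamma>) m j n \<omega>\<bar> \<le> 2 * real m"
        show "\<bar>noise k (- b - \<gamma>) m (par m i \<omega>) n \<omega> - mean_noise k (- b - \<gamma>) m n \<omega>\<bar> \<le> 4 * real m"
          using abs_mean_noise_le[OF n] bspec[OF n p] by linarith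
      qed
      then show "par m i \<omega> \<in> {1..2 ^ m} \<and>
        \<bar>(Z (real (Suc m)) i \<omega> $ k - mean k (Suc m) \<omega>) -
        exp (- b - \<gamma>) * (Z (real m) (par m i \<omega>) \<omega> $ k - mean k m \<omega>)\<bar> \<le> 4 * real m"
        using step i p by (blast intro: limit_le_if_frequently_le)
    qed
  qed
qed

section \<open>The limit of the discounted average\<close>

text \<open>The average at time \<open>m\<close> is determined by the past of \<open>Z\<close>, and the sum by values of the Brownian
motions of the generation started at time \<open>m\<close>.  The sums are used in place of their limit because they
involve finitely many times only, so that their measurability with respect to the Brownian motions does
not depend on exceptional null sets.\<close>

lemma indep_mean_mean_noise:
  "indep_var borel (mean k m) borel (mean_noise k c m n)"
proof -
  let ?N = "{1..2 ^ m} \<times> {real m..<real m + 1}" and ?P = "SIGMA s:{0..real m}. alive s"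
  let ?X = "\<lambda>(i, t). W m i t" and ?Y = "\<lambda>(s, i). Z s i"
  let ?F = "vimage_algebra (space M) (\<lambda>\<omega>. \<lambda>k\<in>?N. ?X k \<omega>) (PiM ?N (\<lambda>_. borel))"
  let ?G = "vimage_algebra (space M) (\<lambda>\<omega>. \<lambda>k\<in>?P. ?Y k \<omega>) (PiM ?P (\<lambda>_. borel))"
  have W: "(\<lambda>\<omega>. W m i t \<omega> $ k) \<in> borel_measurable ?F"
    if "i \<in> {1..2 ^ m}" "t \<in> {real m..<real m + 1}" for i t
    using measurable_sigma_field_coordinate[of "(i, t)" ?N ?X] that
    by (intro measurable_compose[OF _ measurable_vec_nth]) auto
  have Z: "(\<lambda>\<omega>. Z (real m) i \<omega> $ k) \<in> borel_measurable ?G" if "i \<in> {1..2 ^ m}" for i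
    using measurable_sigma_field_coordinate[of "(real m, i)" ?P ?Y] that
    by (intro measurable_compose[OF _ measurable_vec_nth]) (auto simp: alive_of_nat)
  have "mean_noise k c m n \<in> borel_measurable ?F"
    unfolding mean_noise_def noise_def exp_sum_def
    by (intro borel_measurable_divide borel_measurable_sum borel_measurable_times
        borel_measurable_diff borel_measurable_const W) (auto simp: field_simps)
  moreover have "mean k m \<in> borel_measurable ?G"
    unfolding mean_def by (intro borel_measurable_divide borel_measurable_sum borel_measurable_const Z)
  moreover have "indep_set (sets ?F) (sets ?G)"
    using BM_indep_past[of m] unfolding sigma_field_of_def .
  then have "indep_set (sets ?G) (sets ?F)"
    unfolding indep_sets2_eq by (metis Int_commute mult.commute)
  ultimately show ?thesis
    by (intro indep_var_of_indep_set[of ?G ?F]) auto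
qed

text \<open>Before time \<open>1\<close> there is one particle, started at the origin, so the average at time \<open>1\<close> is its noise,
a limit of Gaussian sums.  Each later step adds a limit of variables, each independent of the average
reached so far, which cannot spoil the bound.\<close>

lemma small_balls_discounted_mean:
  assumes b: "b < 0"
  shows "small_balls (2 / exp b) (\<lambda>\<omega>. exp (b * real (Suc m)) * mean k (Suc m) \<omega>)"
proof (induction m)
  case 0
  show ?case
  proof (rule small_balls_limit)
    show "AE \<omega> in M. (\<lambda>n. exp b * noise k (- b) 0 1 n \<omega>) \<longlonglongrightarrow> exp (b * real (Suc 0)) * mean k (Suc 0) \<omega>"
      using AE_generation_step[of k] start
    proof eventually_elim
      case (elim \<omega>)
      have "mean k 0 \<omega> = 0" "(\<lambda>n. mean_noise k (- b) 0 n \<omega>) = (\<lambda>n. noise k (- b) 0 1 n \<omega>)"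
        using elim(2) by (auto simp: mean_def mean_noise_def)
      then have "(\<lambda>n. noise k (- b) 0 1 n \<omega>) \<longlonglongrightarrow> mean k (Suc 0) \<omega>"
        using spec[OF elim(1), of 0] by simp
      then show ?case
        by (intro tendsto_mult) auto
    qed
    show "small_balls (2 / exp b) (\<lambda>\<omega>. exp b * noise k (- b) 0 1 n \<omega>)" for n
      unfolding noise_def using b by (intro small_balls_cmult exp_sum_BM_small_balls BM) auto
  qed measurable
next
  case (Suc m)
  show ?case
  proof (rule small_balls_limit)
    show "AE \<omega> in M. (\<lambda>n. exp (b * real (Suc m)) * mean k (Suc m) \<omega> +
        exp (b * real (Suc (Suc m))) * mean_noise k (- b) (Suc m) n \<omega>)
        \<longlonglongrightarrow> exp (b * real (Suc (Suc m))) * mean k (Suc (Suc m)) \<omega>"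
      using AE_generation_step[of k]
    proof eventually_elim
      case (elim \<omega>)
      have "(\<lambda>n. exp (b * real (Suc m)) * mean k (Suc m) \<omega> +
        exp (b * real (Suc (Suc m))) * mean_noise k (- b) (Suc m) n \<omega>) \<longlonglongrightarrow>
        exp (b * real (Suc m)) * mean k (Suc m) \<omega> + exp (b * real (Suc (Suc m))) *
          (mean k (Suc (Suc m)) \<omega> - exp (- b) * mean k (Suc m) \<omega>)"
        using elim by (intro tendsto_intros) blast
      also have "exp (b * real (Suc m)) * mean k (Suc m) \<omega> + exp (b * real (Suc (Suc m))) *
          (mean k (Suc (Suc m)) \<omega> - exp (- b) * mean k (Suc m) \<omega>) =
          exp (b * real (Suc (Suc m))) * mean k (Suc (Suc m)) \<omega>"
      proof -
        have "exp (b * real (Suc m)) = exp (b * real (Suc (Suc m))) * exp (- b)"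
          by (simp add: exp_add[symmetric] algebra_simps)
        then show ?thesis
          by (simp add: algebra_simps)
      qed
      finally show ?case .
    qed
    have "indep_var borel (\<lambda>\<omega>. exp (b * real (Suc m)) * mean k (Suc m) \<omega>)
        borel (\<lambda>\<omega>. exp (b * real (Suc (Suc m))) * mean_noise k (- b) (Suc m) n \<omega>)" for n
      using indep_var_compose[OF indep_mean_mean_noise[of k "Suc m" "- b" n],
          of "\<lambda>x. exp (b * real (Suc m)) * x" borel "\<lambda>x. exp (b * real (Suc (Suc m))) * x" borel]
      by (simp add: o_def)
    then show "small_balls (2 / exp b) (\<lambda>\<omega>. exp (b * real (Suc m)) * mean k (Suc m) \<omega> +
        exp (b * real (Suc (Suc m))) * mean_noise k (- b) (Suc m) n \<omega>)" for n
      using Suc by (rule small_balls_add_indep)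
  qed measurable
qed

lemma summable_linear_times_exp:
  assumes "b < 0"
  shows "summable (\<lambda>m. real m * exp (b * real (Suc m)))"
proof -
  have "summable (\<lambda>m. of_nat (Suc m) * exp b ^ m)"
    using assms by (intro sums_summable[OF geometric_deriv_sums]) simp
  then have "summable (\<lambda>m. exp b * (real (Suc m) * exp b ^ m))"
    by (intro summable_mult) simp
  then show ?thesis
  proof (rule summable_comparison_test')
    fix m :: nat
    have "exp (b * real (Suc m)) = exp b * exp b ^ m"
      by (simp add: exp_of_nat2_mult[symmetric] exp_add[symmetric] algebra_simps)
    then show "norm (real m * exp (b * real (Suc m))) \<le> exp b * (real (Suc m) * exp b ^ m)"
      by (simp add: mult_ac mult_left_mono)
  qed
qed

text \<open>The increments of the discounted average are eventually at most \<open>2 m exp (b (m + 1))\<close>, hence absolutely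
summable.  The bound on small balls, uniform in \<open>m\<close>, passes to the limit and excludes the value
\<open>0\<close>.\<close>

lemma AE_discounted_mean_convergent:
  assumes b: "b < 0"
  shows "AE \<omega> in M. \<exists>l. l \<noteq> 0 \<and> (\<lambda>m. exp (b * real m) * mean k m \<omega>) \<longlonglongrightarrow> l"
proof -
  let ?S = "\<lambda>m \<omega>. exp (b * real m) * mean k m \<omega>"
  have conv: "AE \<omega> in M. (\<lambda>m. ?S m \<omega>) \<longlonglongrightarrow> lim (\<lambda>m. ?S m \<omega>)"
    using AE_mean_step_bound[of k]
  proof eventually_elim
    case (elim \<omega>)
    have diff: "?S (Suc m) \<omega> - ?S m \<omega> =
        exp (b * real (Suc m)) * (mean k (Suc m) \<omega> - exp (- b) * mean k m \<omega>)" for m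
    proof -
      have "exp (b * real m) = exp (b * real (Suc m)) * exp (- b)"
        by (simp add: exp_add[symmetric] algebra_simps)
      then show ?thesis
        by (simp add: algebra_simps)
    qed
    have "summable (\<lambda>m. ?S (Suc m) \<omega> - ?S m \<omega>)"
    proof (rule summable_comparison_test_ev)
      show "summable (\<lambda>m. 2 * (real m * exp (b * real (Suc m))))"
        by (intro summable_mult summable_linear_times_exp b)
      show "\<forall>\<^sub>F m in sequentially. norm (?S (Suc m) \<omega> - ?S m \<omega>) \<le> 2 * (real m * exp (b * real (Suc m)))"
        using elim
      proof eventually_elim
        case (elim m)
        then show ?case
          unfolding diff by (simp add: abs_mult mult_ac mult_left_mono del: of_nat_Suc)
      qed
    qed
    then have "(\<lambda>n. \<Sum>m<n. ?S (Suc m) \<omega> - ?S m \<omega>) \<longlonglongrightarrow> (\<Sum>m. ?S (Suc m) \<omega> - ?S m \<omega>)"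
      by (rule summable_LIMSEQ)
    then have "(\<lambda>n. (\<Sum>m<n. ?S (Suc m) \<omega> - ?S m \<omega>) + ?S 0 \<omega>) \<longlonglongrightarrow>
        (\<Sum>m. ?S (Suc m) \<omega> - ?S m \<omega>) + ?S 0 \<omega>"
      by (intro tendsto_intros)
    moreover have "(\<Sum>m<n. ?S (Suc m) \<omega> - ?S m \<omega>) + ?S 0 \<omega> = ?S n \<omega>" for n
      using sum_lessThan_telescope[of "\<lambda>m. ?S m \<omega>" n] by linarith
    ultimately have "(\<lambda>m. ?S m \<omega>) \<longlonglongrightarrow> (\<Sum>m. ?S (Suc m) \<omega> - ?S m \<omega>) + ?S 0 \<omega>"
      by (simp only:)
    then have "convergent (\<lambda>m. ?S m \<omega>)"
      unfolding convergent_def by blast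
    then show ?case
      by (simp add: convergent_LIMSEQ_iff)
  qed
  have "AE \<omega> in M. lim (\<lambda>m. ?S m \<omega>) \<noteq> 0"
  proof (rule small_balls_AE_nonzero)
    show "small_balls (2 / exp b) (\<lambda>\<omega>. lim (\<lambda>m. ?S m \<omega>))"
    proof (rule small_balls_limit[OF _ _ _ small_balls_discounted_mean[OF b]])
      show "AE \<omega> in M. (\<lambda>m. ?S (Suc m) \<omega>) \<longlonglongrightarrow> lim (\<lambda>m. ?S m \<omega>)"
        using conv by eventually_elim (rule LIMSEQ_Suc, simp)
      show "random_variable borel (\<lambda>\<omega>. lim (\<lambda>m. ?S m \<omega>))"
        by (intro borel_measurable_lim_metric) measurable
    qed measurable
    show "random_variable borel (\<lambda>\<omega>. lim (\<lambda>m. ?S m \<omega>))"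
      by (intro borel_measurable_lim_metric) measurable
  qed
  with conv show ?thesis
    by eventually_elim blast
qed

section \<open>Escape of all particles\<close>

text \<open>The maximal deviation \<open>V\<close> eventually satisfies \<open>V (m + 1) \<le> exp (- b - \<gamma>) V m + 4 m\<close>.
After multiplication by \<open>exp (b (m + 1))\<close> the factor becomes \<open>exp (- \<gamma>) < 1\<close> and the error term tends
to \<open>0\<close>, for either sign of \<open>- b - \<gamma>\<close>.\<close>

lemma AE_discounted_deviation_vanishes:
  assumes b: "b < 0" and g: "\<gamma> > 0"
  shows "AE \<omega> in M. \<exists>r. r \<longlonglongrightarrow> 0 \<and>
    (\<forall>m. \<forall>i\<in>{1..2 ^ m}. exp (b * real m) * \<bar>Z (real m) i \<omega> $ k - mean k m \<omega>\<bar> \<le> r m)"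
  using AE_deviation_step_bound[of k]
proof eventually_elim
  case (elim \<omega>)
  define v where "v m i = \<bar>Z (real m) i \<omega> $ k - mean k m \<omega>\<bar>" for m i
  define V where "V m = Max (v m ` {1..2 ^ m})" for m
  have v_le: "v m i \<le> V m" if "i \<in> {1..2 ^ m}" for m i
    unfolding V_def using that by (intro Max_ge) auto
  have V_nonneg: "0 \<le> V m" for m
    using v_le[of 1 m] order_trans[of 0 "v m 1"] by (simp add: v_def)
  have "(\<lambda>m. exp (b * real m) * V m) \<longlonglongrightarrow> 0"
  proof (rule contraction_with_vanishing_error[where q="exp (- \<gamma>)"])
    show "\<forall>\<^sub>F m in sequentially. exp (b * real (Suc m)) * V (Suc m) \<le>
        exp (- \<gamma>) * (exp (b * real m) * V m) + 4 * (real m * exp (b * real (Suc m)))"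
      using elim
    proof eventually_elim
      case (elim m)
      have "V (Suc m) \<le> exp (- b - \<gamma>) * V m + 4 * real m"
        unfolding V_def[of "Suc m"]
      proof (rule Max.boundedI)
        fix x assume "x \<in> v (Suc m) ` {1..2 ^ Suc m}"
        then obtain i where i: "i \<in> {1..2 ^ Suc m}" and x: "x = v (Suc m) i"
          by blast
        have p: "par m i \<omega> \<in> {1..2 ^ m}" and le:
          "\<bar>(Z (real (Suc m)) i \<omega> $ k - mean k (Suc m) \<omega>) -
            exp (- b - \<gamma>) * (Z (real m) (par m i \<omega>) \<omega> $ k - mean k m \<omega>)\<bar> \<le> 4 * real m"
          using elim i by blast+
        have "x \<le> exp (- b - \<gamma>) * v m (par m i \<omega>) + 4 * real m"
          using le abs_triangle_ineq2[of "Z (real (Suc m)) i \<omega> $ k - mean k (Suc m) \<omega>"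
              "exp (- b - \<gamma>) * (Z (real m) (par m i \<omega>) \<omega> $ k - mean k m \<omega>)"]
          unfolding x v_def abs_mult by simp
        also have "\<dots> \<le> exp (- b - \<gamma>) * V m + 4 * real m"
          using v_le[OF p] by simp
        finally show "x \<le> exp (- b - \<gamma>) * V m + 4 * real m" .
      qed auto
      then have "exp (b * real (Suc m)) * V (Suc m) \<le>
          exp (b * real (Suc m)) * (exp (- b - \<gamma>) * V m + 4 * real m)"
        by (intro mult_left_mono) auto
      also have "\<dots> = (exp (b * real (Suc m)) * exp (- b - \<gamma>)) * V m +
          4 * (real m * exp (b * real (Suc m)))"
        by (simp add: distrib_left mult_ac del: of_nat_Suc)
      also have "exp (b * real (Suc m)) * exp (- b - \<gamma>) = exp (- \<gamma>) * exp (b * real m)"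
        by (simp add: exp_add[symmetric] algebra_simps)
      finally show ?case
        by (simp add: mult.assoc)
    qed
    show "(\<lambda>m. 4 * (real m * exp (b * real (Suc m)))) \<longlonglongrightarrow> 0"
      by (intro summable_LIMSEQ_zero summable_mult summable_linear_times_exp b)
  qed (use g V_nonneg in auto)
  moreover have "exp (b * real m) * \<bar>Z (real m) i \<omega> $ k - mean k m \<omega>\<bar> \<le> exp (b * real m) * V m"
    if "i \<in> {1..2 ^ m}" for m i
    using v_le[OF that] by (simp add: v_def)
  ultimately show ?case
    by (intro exI[of _ "\<lambda>m. exp (b * real m) * V m"]) blast
qed

text \<open>With \<open>l\<close> the limit of the discounted average, every particle has a coordinate of modulus at least
\<open>exp (- b m) (\<bar>l\<bar> - o(1))\<close>, with an error term common to all particles.\<close>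

lemma AE_all_particles_escape:
  assumes b: "b < 0" and g: "\<gamma> > 0"
  shows "AE \<omega> in M. \<forall>R. \<forall>\<^sub>F m in sequentially. \<forall>i\<in>alive (real m). R < norm (Z (real m) i \<omega>)"
proof -
  obtain k :: 'd where True by simp
  show ?thesis
    using AE_discounted_mean_convergent[OF b, of k] AE_discounted_deviation_vanishes[OF b g, of k]
  proof eventually_elim
    case (elim \<omega>)
    obtain l where l: "l \<noteq> 0" "(\<lambda>m. exp (b * real m) * mean k m \<omega>) \<longlonglongrightarrow> l"
      using elim(1) by blast
    obtain r where r: "r \<longlonglongrightarrow> 0"
      "\<And>m i. i \<in> {1..2 ^ m} \<Longrightarrow> exp (b * real m) * \<bar>Z (real m) i \<omega> $ k - mean k m \<omega>\<bar> \<le> r m"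
      using elim(2) by blast
    show ?case
    proof
      fix R
      have "(\<lambda>m. \<bar>exp (b * real m) * mean k m \<omega>\<bar> - r m) \<longlonglongrightarrow> \<bar>l\<bar> - 0"
        by (intro tendsto_intros l r)
      moreover have "(\<lambda>m. R * exp b ^ m) \<longlonglongrightarrow> R * 0"
        using b by (intro tendsto_intros LIMSEQ_power_zero) simp
      ultimately have "(\<lambda>m. \<bar>exp (b * real m) * mean k m \<omega>\<bar> - r m - R * exp b ^ m) \<longlonglongrightarrow> \<bar>l\<bar> - 0 - R * 0"
        by (rule tendsto_diff)
      then have "\<forall>\<^sub>F m in sequentially. 0 < \<bar>exp (b * real m) * mean k m \<omega>\<bar> - r m - R * exp b ^ m"
        using l by (intro order_tendstoD(1)) auto
      then show "\<forall>\<^sub>F m in sequentially. \<forall>i\<in>alive (real m). R < norm (Z (real m) i \<omega>)"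
      proof eventually_elim
        case (elim m)
        show ?case
        proof
          fix i assume "i \<in> alive (real m)"
          then have "exp (b * real m) * \<bar>Z (real m) i \<omega> $ k - mean k m \<omega>\<bar> \<le> r m"
            by (intro r) (simp add: alive_of_nat)
          moreover have "exp b ^ m = exp (b * real m)"
            by (simp add: exp_of_nat2_mult)
          ultimately have "exp (b * real m) * R < exp (b * real m) * \<bar>mean k m \<omega>\<bar> -
              exp (b * real m) * \<bar>Z (real m) i \<omega> $ k - mean k m \<omega>\<bar>"
            using elim by (simp add: abs_mult mult.commute)
          also have "\<dots> = exp (b * real m) * (\<bar>mean k m \<omega>\<bar> - \<bar>Z (real m) i \<omega> $ k - mean k m \<omega>\<bar>)"
            by (simp add: right_diff_distrib)
          also have "\<dots> \<le> exp (b * real m) * \<bar>Z (real m) i \<omega> $ k\<bar>"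
            by (intro mult_left_mono) auto
          finally have "R < \<bar>Z (real m) i \<omega> $ k\<bar>"
            by simp
          also have "\<dots> \<le> norm (Z (real m) i \<omega>)"
            by (rule component_le_norm_cart)
          finally show "R < norm (Z (real m) i \<omega>)" .
        qed
      qed
    qed
  qed
qed

end

text \<open>A test function vanishes outside some ball, so its integral is eventually exactly \<open>0\<close>.\<close>

lemma vague_conv_null_if_particles_escape:
  fixes Z :: "real \<Rightarrow> nat \<Rightarrow> 'w \<Rightarrow> real ^ 'd"
  assumes escape: "\<And>R. \<forall>\<^sub>F m in sequentially. \<forall>i\<in>alive (real m). R < norm (Z (real m) i \<omega>)"
  shows "vague_conv (\<lambda>n. particle_measure Z (real n) \<omega>) (null_measure borel)"
  unfolding vague_conv_def
proof (intro allI impI)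
  fix f :: "real ^ 'd \<Rightarrow> real"
  assume f: "continuous_on UNIV f \<and> compact (closure {x. f x \<noteq> 0})"
  then have "bounded {x. f x \<noteq> 0}"
    by (meson bounded_subset closure_subset compact_imp_bounded)
  then obtain R where R: "\<And>x. f x \<noteq> 0 \<Longrightarrow> norm x \<le> R"
    unfolding bounded_iff by auto
  have [measurable]: "f \<in> borel_measurable borel"
    using f by (simp add: borel_measurable_continuous_onI)
  have "\<forall>\<^sub>F n in sequentially. integral\<^sup>L (particle_measure Z (real n) \<omega>) f = 0"
    using escape[of R]
  proof eventually_elim
    case (elim n)
    have "AE x in particle_measure Z (real n) \<omega>. f x = 0"
    proof (rule AE_I')
      have "{x. f x \<noteq> 0} \<in> sets borel"
        by measurable
      moreover have "indicator {x. f x \<noteq> 0} (Z (real n) i \<omega>) = (0 :: ennreal)" if "i \<in> alive (real n)" for i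
        using R elim that by (force simp: indicator_def not_le)
      ultimately show "{x. f x \<noteq> 0} \<in> null_sets (particle_measure Z (real n) \<omega>)"
        by (simp add: null_sets_def emeasure_particle_measure)
    qed simp
    then show ?case
      by (rule integral_eq_zero_AE)
  qed
  then have "(\<lambda>n. integral\<^sup>L (particle_measure Z (real n) \<omega>) f) \<longlonglongrightarrow> 0"
    by (rule tendsto_eventually)
  then show "(\<lambda>n. integral\<^sup>L (particle_measure Z (real n) \<omega>) f) \<longlonglongrightarrow> integral\<^sup>L (null_measure borel) f"
    by simp
qed

theorem theorem7p3:
  fixes M :: "'w measure"
    and b \<gamma> :: real
    and W :: "nat \<Rightarrow> nat \<Rightarrow> real \<Rightarrow> 'w \<Rightarrow> real ^ 'd"
    and par :: "nat \<Rightarrow> nat \<Rightarrow> 'w \<Rightarrow> nat"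
    and Z :: "real \<Rightarrow> nat \<Rightarrow> 'w \<Rightarrow> real ^ 'd"
  assumes "interacting_branching_diffusion M b \<gamma> W par Z"
    and "b < 0"
    and "\<gamma> > 0"
  shows "local_extinction M Z"
proof -
  interpret interacting_branching_diffusion M b \<gamma> W par Z
    by fact
  show ?thesis
    unfolding local_extinction_def
    using AE_all_particles_escape[OF assms(2,3)]
    by eventually_elim (blast intro: vague_conv_null_if_particles_escape)
qed

end
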